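(* Let $\mu=\sum_{i<j}\mu_{ij}^kv_{ijk}$ be a nonzero element of $V$. (i) $p_{\mathfrak{t}}\left(\frac{4}{\|\mu\|^2}\mathrm{Ric}_\mu\right)=\frac{2}{\|\mu\|^2}\sum_{i<j}(\mu_{ij}^k)^2\alpha_{ij}^k\in\mathrm{CH}\{\alpha_{ij}^k:\mu_{ij}^k\ne0\}$, and consequently $F(\mu)\ge\|\beta_\mu\|^2$. (ii) If $\mu\in\mathcal{S}_\beta$ ($\beta\in\mathfrak{t}$) then $F(\mu)\ge\|\beta\|^2$. (iii) If $\mu\in W_\beta$ ($\beta\in\mathfrak{t}$) and $\inf F(\mathrm{GL}_n.\mu)=\|\beta\|^2$, then $\mu\in\mathcal{S}_\beta$. (iv) If $\inf F(\mathrm{GL}_n.\mu)=\|\beta_\mu\|^2$ then $\mu\in\mathcal{S}_\beta$, where $\beta$ is the only element of $\mathfrak{t}^+$ that is conjugate to $\beta_\mu$.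
   Context: $\mathbb{R}^n$ has its canonical inner product and canonical basis $e_1,\dots,e_n$. $V=\Lambda^2(\mathbb{R}^n)^*\otimes\mathbb{R}^n$ is the space of skew-symmetric bilinear maps $\mathbb{R}^n\times\mathbb{R}^n\to\mathbb{R}^n$, with $\mathrm{GL}_n=\mathrm{GL}_n(\mathbb{R})$ acting by $g.\mu(X,Y)=g\mu(g^{-1}X,g^{-1}Y)$ and inner product $\langle\mu,\lambda\rangle=\sum_{i,j,k}\langle\mu(e_i,e_j),e_k\rangle\langle\lambda(e_i,e_j),e_k\rangle$ (sum over all $i,j,k$). For $i<j$, $v_{ijk}\in V$ is defined by $v_{ijk}(e_i,e_j)=-v_{ijk}(e_j,e_i)=e_k$ and zero on other pairs of basis vectors. Matrices carry the inner product $\langle\alpha,\beta\rangle=\mathrm{tr}(\alpha\beta^t)$. For $\mu\in V$ the symmetric operator $\mathrm{Ric}_\mu$ on $\mathbb{R}^n$ is defined by $\langle\mathrm{Ric}_\mu X,Y\rangle=-\frac12\sum_{i,j}\langle\mu(X,e_i),e_j\rangle\langle\mu(Y,e_i),e_j\rangle+\frac14\sum_{i,j}\langle\mu(e_i,e_j),X\rangle\langle\mu(e_i,e_j),Y\rangle$, and for $\mu\ne0$, $F(\mu)=16\,\mathrm{tr}(\mathrm{Ric}_\mu^2)/\|\mu\|^4$. $\mathfrak{t}$ is the set of diagonal $n\times n$ real matrices, $\mathfrak{t}^+=\{\mathrm{diag}(a_1,\dots,a_n):a_1\le\dots\le a_n\}$, and $p_{\mathfrak{t}}(\alpha)$ is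 the orthogonal projection of a symmetric matrix $\alpha$ on $\mathfrak{t}$ (its diagonal part). Let $E_{rs}$ be the matrix with $1$ in entry $rs$ and zeros elsewhere, and $\alpha_{ij}^k=E_{kk}-E_{ii}-E_{jj}\in\mathfrak{t}$ for $i<j$. $\mathrm{CH}$ denotes convex hull. For $0\ne\mu\in V$, $\beta_\mu\in\mathfrak{t}$ is the unique vector of minimal norm in $\mathrm{CH}\{\alpha_{ij}^k:i<j,\ \mu_{ij}^k\ne0\}$. For $\beta\in\mathfrak{t}$, $\mathcal{S}_\beta$ is the set of nonzero $\mu\in V$ such that $\beta$ is an element of maximal norm of the finite set $\{\beta_{g.\mu}:g\in\mathrm{GL}_n\}$, and $W_\beta=\{\mu\in V:\langle\beta,\alpha_{ij}^k\rangle\ge\|\beta\|^2\ \text{whenever } i<j,\ \mu_{ij}^k\ne0\}$. *)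

theory Defs
  imports "HOL-Analysis.Analysis"
begin

text \<open>
  The space R^n is \<open>real ^ 'n\<close> with \<open>'n\<close> a finite linearly ordered type; its order plays the
  role of the order of the indices \<open>1, ..., n\<close>.  The basis vector \<open>e_i\<close> is \<open>axis i 1\<close>, and operators
  on R^n are identified with their matrices in this basis.
\<close>

type_synonym 'n bil = "(real, 'n) vec \<Rightarrow> (real, 'n) vec \<Rightarrow> (real, 'n) vec"
type_synonym 'n mat = "((real, 'n) vec, 'n) vec"

abbreviation e :: "'n::finite \<Rightarrow> real ^ 'n" where
  "e i \<equiv> axis i 1"

section \<open>Skew-symmetric bilinear maps\<close>

definition V :: "'n::finite bil set" where
  "V = {\<mu>. bilinear \<mu> \<and> (\<forall>X Y. \<mu> X Y = - \<mu> Y X)}"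

definition GL :: "'n::finite mat set" where
  "GL = {g. invertible g}"

definition act :: "'n::finite mat \<Rightarrow> 'n bil \<Rightarrow> 'n bil" where
  "act g \<mu> = (\<lambda>X Y. g *v \<mu> (matrix_inv g *v X) (matrix_inv g *v Y))"

definition orbit :: "'n::finite bil \<Rightarrow> 'n bil set" where
  "orbit \<mu> = (\<lambda>g. act g \<mu>) ` GL"

definition innerV :: "'n::finite bil \<Rightarrow> 'n bil \<Rightarrow> real" where
  "innerV \<mu> \<nu> = (\<Sum>i\<in>UNIV. \<Sum>j\<in>UNIV. \<Sum>k\<in>UNIV. (\<mu> (e i) (e j) \<bullet> e k) * (\<nu> (e i) (e j) \<bullet> e k))"

definition normV :: "'n::finite bil \<Rightarrow> real" where
  "normV \<mu> = sqrt (innerV \<mu> \<mu>)"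

text \<open>For \<open>i < j\<close> this is the skew-symmetric map of the standard basis of \<open>V\<close>, see \<open>v_on_basis\<close>.\<close>

definition v :: "'n::finite \<Rightarrow> 'n \<Rightarrow> 'n \<Rightarrow> 'n bil" where
  "v i j k = (\<lambda>X Y. (X $ i * Y $ j - X $ j * Y $ i) *\<^sub>R e k)"

text \<open>The coefficient \<open>\<mu>_ij^k\<close> of \<open>v i j k\<close> in \<open>\<mu>\<close>, see \<open>V_expansion\<close> and \<open>sc_expansion\<close>.\<close>

definition sc :: "'n::finite bil \<Rightarrow> 'n \<Rightarrow> 'n \<Rightarrow> 'n \<Rightarrow> real" where
  "sc \<mu> i j k = \<mu> (e i) (e j) \<bullet> e k"

lemma v_on_basis:
  fixes i j k :: "'n::{finite,linorder}"
  assumes "i < j"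
  shows "v i j k (e i) (e j) = e k" "v i j k (e j) (e i) = - e k"
    "(p, q) \<noteq> (i, j) \<Longrightarrow> (p, q) \<noteq> (j, i) \<Longrightarrow> v i j k (e p) (e q) = 0"
  using assms by (auto simp: v_def axis_def)

lemma v_in_V: "v i j k \<in> V"
  by (auto simp: V_def v_def bilinear_def algebra_simps
      intro!: linearI)

lemma bilinear_basis_expansion:
  fixes \<mu> :: "'n::finite bil"
  assumes "bilinear \<mu>"
  shows "\<mu> X Y = (\<Sum>i\<in>UNIV. \<Sum>j\<in>UNIV. (X $ i * Y $ j) *\<^sub>R \<mu> (e i) (e j))"
proof -
  have X: "X = (\<Sum>i\<in>UNIV. X $ i *\<^sub>R e i)" and Y: "Y = (\<Sum>i\<in>UNIV. Y $ i *\<^sub>R e i)"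
    using basis_expansion[of X] basis_expansion[of Y] by (simp_all add: scalar_mult_eq_scaleR)
  have "\<mu> X Y = \<mu> (\<Sum>i\<in>UNIV. X $ i *\<^sub>R e i) (\<Sum>i\<in>UNIV. Y $ i *\<^sub>R e i)"
    using X Y by simp
  also have "\<dots> = (\<Sum>(i,j)\<in>UNIV \<times> UNIV. \<mu> (X $ i *\<^sub>R e i) (Y $ j *\<^sub>R e j))"
    by (rule bilinear_sum[OF assms])
  also have "\<dots> = (\<Sum>i\<in>UNIV. \<Sum>j\<in>UNIV. (X $ i * Y $ j) *\<^sub>R \<mu> (e i) (e j))"
    by (simp add: sum.cartesian_product bilinear_lmul[OF assms] bilinear_rmul[OF assms] case_prod_beta mult.commute)
  finally show ?thesis .
qed

lemma sc_expansion:
  fixes c :: "'n::{finite,linorder} \<Rightarrow> 'n \<Rightarrow> 'n \<Rightarrow> real"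
  assumes "p < q"
  shows "sc (\<lambda>X Y. \<Sum>(i,j,k)\<in>{(i,j,k). i < j}. c i j k *\<^sub>R v i j k X Y) p q r = c p q r"
proof -
  have ax: "e i $ j = (if j = i then 1 else 0 :: real)" for i j :: 'n
    by (simp add: axis_def)
  have "sc (\<lambda>X Y. \<Sum>(i,j,k)\<in>{(i,j,k). i < j}. c i j k *\<^sub>R v i j k X Y) p q r
      = (\<Sum>x\<in>{(i,j,k). i < j}. if x = (p,q,r) then c p q r else 0)"
    unfolding sc_def inner_sum_left
  proof (rule sum.cong[OF refl])
    fix x :: "'n \<times> 'n \<times> 'n" assume "x \<in> {(i, j, k). i < j}"
    then obtain i j k where x: "x = (i, j, k)" and "i < j" by auto
    then have "\<not> (i = q \<and> j = p)" using assms by auto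
    then show "(case x of (i, j, k) \<Rightarrow> c i j k *\<^sub>R v i j k (e p) (e q)) \<bullet> e r
        = (if x = (p, q, r) then c p q r else 0)"
      by (auto simp: x v_def inner_axis_axis ax)
  qed
  then show ?thesis
    using assms by (simp add: sum.delta)
qed

lemma V_expansion:
  fixes \<mu> :: "'n::{finite,linorder} bil"
  assumes "\<mu> \<in> V"
  shows "\<mu> = (\<lambda>X Y. \<Sum>(i,j,k)\<in>{(i,j,k). i < j}. sc \<mu> i j k *\<^sub>R v i j k X Y)" (is "_ = ?\<nu>")
proof -
  have bil: "bilinear \<mu>" and skew: "\<mu> X Y = - \<mu> Y X" for X Y
    using assms unfolding V_def by blast+
  have vl: "linear (v i j k X)" and vr: "linear (\<lambda>Y. v i j k Y X)" for i j k :: 'n and X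
    using v_in_V[of i j k] unfolding V_def bilinear_def by blast+
  have bil': "bilinear ?\<nu>"
    unfolding bilinear_def case_prod_beta
  proof (intro conjI allI linear_compose_sum ballI)
    fix X :: "(real, 'n) vec" and x :: "'n \<times> 'n \<times> 'n"
    show "linear (\<lambda>Y. sc \<mu> (fst x) (fst (snd x)) (snd (snd x)) *\<^sub>R v (fst x) (fst (snd x)) (snd (snd x)) X Y)"
      "linear (\<lambda>Y. sc \<mu> (fst x) (fst (snd x)) (snd (snd x)) *\<^sub>R v (fst x) (fst (snd x)) (snd (snd x)) Y X)"
      by (intro linear_compose_scale_right vl vr)+
  qed
  have skew': "?\<nu> X Y = - ?\<nu> Y X" for X Y
    unfolding sum_negf[symmetric] v_def
    by (intro sum.cong) (auto simp: scaleR_left_diff_distrib scaleR_right_diff_distrib mult.commute)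
  have lt: "\<mu> (e p) (e q) = ?\<nu> (e p) (e q)" if "p < q" for p q
    using sc_expansion[OF that, of "sc \<mu>"]
    by (simp add: vec_eq_iff sc_def inner_axis)
  have "\<mu> (e p) (e q) = ?\<nu> (e p) (e q)" for p q
  proof (cases p q rule: linorder_cases)
    case less
    then show ?thesis by (rule lt)
  next
    case equal
    have zero: "x = 0" if "x = - x" for x :: "(real, 'n) vec"
      using that by (metis neg_eq_iff_add_eq_0 scaleR_2 scaleR_eq_0_iff zero_neq_numeral)
    show ?thesis
      unfolding equal zero[OF skew[of "e q" "e q"]] zero[OF skew'[of "e q" "e q"]] ..
  next
    case greater
    show ?thesis
      unfolding skew[of "e p" "e q"] skew'[of "e p" "e q"] lt[OF greater] ..
  qed
  then have "\<mu> X Y = ?\<nu> X Y" for X Y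
    unfolding bilinear_basis_expansion[OF bil, of X Y] bilinear_basis_expansion[OF bil', of X Y]
    by (intro sum.cong refl arg_cong[where f = "scaleR _"])
  then show ?thesis
    by (intro ext)
qed

section \<open>The Ricci operator and the functional F\<close>

definition ric_form :: "'n::finite bil \<Rightarrow> real ^ 'n \<Rightarrow> real ^ 'n \<Rightarrow> real" where
  "ric_form \<mu> X Y =
    - (1/2) * (\<Sum>i\<in>UNIV. \<Sum>j\<in>UNIV. (\<mu> X (e i) \<bullet> e j) * (\<mu> Y (e i) \<bullet> e j))
    + (1/4) * (\<Sum>i\<in>UNIV. \<Sum>j\<in>UNIV. (\<mu> (e i) (e j) \<bullet> X) * (\<mu> (e i) (e j) \<bullet> Y))"

text \<open>The matrix of the operator representing \<open>ric_form \<mu>\<close>, see \<open>Ric_inner\<close>.\<close>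

definition Ric :: "'n::finite bil \<Rightarrow> 'n mat" where
  "Ric \<mu> = (\<chi> r s. ric_form \<mu> (e s) (e r))"

lemma Ric_inner:
  fixes \<mu> :: "'n::finite bil"
  assumes "\<mu> \<in> V"
  shows "(Ric \<mu> *v X) \<bullet> Y = ric_form \<mu> X Y"
proof -
  have bil: "bilinear \<mu>" using assms by (simp add: V_def)
  have L: "linear (\<lambda>X. \<mu> X Z)" for Z
    using bil by (simp add: bilinear_def)
  have add: "\<mu> (A + B) Z = \<mu> A Z + \<mu> B Z" for A B Z
    using linear_add[OF L[of Z]] .
  have scale: "\<mu> (c *\<^sub>R A) Z = c *\<^sub>R \<mu> A Z" for A Z c
    using linear_scale[OF L[of Z]] .
  have sym: "ric_form \<mu> X Y = ric_form \<mu> Y X" for X Y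
    by (simp add: ric_form_def mult.commute)
  have bl1: "linear (\<lambda>X. ric_form \<mu> X Y)" for Y
  proof (rule linearI)
    show "ric_form \<mu> (A + B) Y = ric_form \<mu> A Y + ric_form \<mu> B Y" for A B
      by (simp add: ric_form_def add inner_add_left inner_add_right distrib_right sum.distrib
          add_divide_distrib)
    show "ric_form \<mu> (c *\<^sub>R A) Y = c *\<^sub>R ric_form \<mu> A Y" for c A
      by (simp add: ric_form_def scale mult.assoc right_diff_distrib flip: sum_distrib_left)
  qed
  have "ric_form \<mu> X = (\<lambda>Y. ric_form \<mu> Y X)" for X
    by (rule ext) (rule sym)
  then have bl2: "linear (ric_form \<mu> X)" for X
    using bl1[of X] by metis
  note bl = bl1 bl2
  have exp: "Z = (\<Sum>i\<in>UNIV. Z $ i *\<^sub>R e i)" for Z :: "real ^ 'n"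
    using basis_expansion[of Z] by (simp add: scalar_mult_eq_scaleR)
  have l: "ric_form \<mu> Z W = (\<Sum>s\<in>UNIV. Z $ s * ric_form \<mu> (e s) W)" for Z W
    by (subst exp[of Z]) (simp add: linear_sum[OF bl(1)] linear_scale[OF bl(1)])
  have r: "ric_form \<mu> Z W = (\<Sum>s\<in>UNIV. W $ s * ric_form \<mu> Z (e s))" for Z W
    by (subst exp[of W]) (simp add: linear_sum[OF bl(2)] linear_scale[OF bl(2)])
  have "ric_form \<mu> X Y = (\<Sum>r\<in>UNIV. (\<Sum>s\<in>UNIV. X $ s * ric_form \<mu> (e s) (e r)) * Y $ r)"
    by (subst r, subst l) (simp add: mult.commute)
  also have "\<dots> = (Ric \<mu> *v X) \<bullet> Y"
    by (simp add: Ric_def matrix_vector_mult_def inner_vec_def mult.commute)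
  finally show ?thesis ..
qed

lemma Ric_symmetric: "transpose (Ric \<mu>) = Ric \<mu>"
  by (simp add: Ric_def transpose_def vec_eq_iff ric_form_def mult.commute)

definition F :: "'n::finite bil \<Rightarrow> real" where
  "F \<mu> = 16 * trace (Ric \<mu> ** Ric \<mu>) / normV \<mu> ^ 4"

section \<open>Diagonal matrices\<close>

text \<open>The library inner product of \<open>'n mat\<close> is the trace form, so its \<open>norm\<close> is the
  norm used on matrices throughout.\<close>

lemma inner_matrix_eq_trace:
  fixes A B :: "'n::finite mat"
  shows "A \<bullet> B = trace (A ** transpose B)"
  by (simp add: inner_vec_def trace_def matrix_matrix_mult_def transpose_def)

definition t :: "'n::finite mat set" where
  "t = {A. \<forall>i j. i \<noteq> j \<longrightarrow> A $ i $ j = 0}"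

definition t_plus :: "'n::{finite,linorder} mat set" where
  "t_plus = {A \<in> t. \<forall>i j. i \<le> j \<longrightarrow> A $ i $ i \<le> A $ j $ j}"

definition p_t :: "'n::finite mat \<Rightarrow> 'n mat" where
  "p_t A = (\<chi> i j. if i = j then A $ i $ j else 0)"

lemma p_t_orthogonal_projection:
  "p_t A \<in> t" "D \<in> t \<Longrightarrow> (A - p_t A) \<bullet> D = 0"
  by (auto simp: p_t_def t_def inner_vec_def intro!: sum.neutral)

definition conjugate :: "'n::finite mat \<Rightarrow> 'n mat \<Rightarrow> bool" where
  "conjugate A B \<longleftrightarrow> (\<exists>g\<in>GL. A = g ** B ** matrix_inv g)"

definition E :: "'n::finite \<Rightarrow> 'n \<Rightarrow> 'n mat" where
  "E r s = (\<chi> p q. if p = r \<and> q = s then 1 else 0)"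

definition \<alpha> :: "'n::finite \<Rightarrow> 'n \<Rightarrow> 'n \<Rightarrow> 'n mat" where
  "\<alpha> i j k = E k k - E i i - E j j"

definition weights :: "'n::{finite,linorder} bil \<Rightarrow> 'n mat set" where
  "weights \<mu> = {\<alpha> i j k | i j k. i < j \<and> sc \<mu> i j k \<noteq> 0}"

text \<open>For \<open>0 \<noteq> \<mu> \<in> V\<close> the vector of minimal norm exists and is unique, see \<open>\<beta>min_ex1\<close>.\<close>

definition \<beta>min :: "'n::{finite,linorder} bil \<Rightarrow> 'n mat" where
  "\<beta>min \<mu> = (THE \<beta>. \<beta> \<in> convex hull (weights \<mu>) \<and> (\<forall>\<gamma> \<in> convex hull (weights \<mu>). norm \<beta> \<le> norm \<gamma>))"

lemma weights_subset: "weights \<mu> \<subseteq> range (\<lambda>(i,j,k). \<alpha> i j k)"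
  unfolding weights_def by (auto intro: range_eqI[where x = "(_, _, _)"])

lemma finite_weights: "finite (weights \<mu>)"
  using weights_subset by (rule finite_subset) simp

lemma weights_nonempty:
  assumes "\<mu> \<in> V" "\<mu> \<noteq> (\<lambda>X Y. 0)"
  shows "weights \<mu> \<noteq> {}"
proof
  assume "weights \<mu> = {}"
  then have "\<And>i j k. i < j \<Longrightarrow> sc \<mu> i j k = 0"
    by (auto simp: weights_def)
  then have "(\<lambda>X Y. \<Sum>(i,j,k)\<in>{(i,j,k). i < j}. sc \<mu> i j k *\<^sub>R v i j k X Y) = (\<lambda>X Y. 0)"
    by (intro ext sum.neutral) auto
  with V_expansion[OF assms(1)] assms(2) show False by simp
qed

lemma \<beta>min_ex1:
  assumes "\<mu> \<in> V" "\<mu> \<noteq> (\<lambda>X Y. 0)"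
  shows "\<exists>!\<beta>. \<beta> \<in> convex hull (weights \<mu>) \<and> (\<forall>\<gamma> \<in> convex hull (weights \<mu>). norm \<beta> \<le> norm \<gamma>)"
proof -
  let ?C = "convex hull (weights \<mu>)"
  have C: "closed ?C" "convex ?C" "?C \<noteq> {}"
    using finite_weights weights_nonempty[OF assms]
    by (auto intro: compact_imp_closed finite_imp_compact_convex_hull)
  show ?thesis
  proof (rule ex1I)
    show "closest_point ?C 0 \<in> ?C \<and> (\<forall>\<gamma>\<in>?C. norm (closest_point ?C 0) \<le> norm \<gamma>)"
      using closest_point_exists[OF C(1,3), of 0] by simp
    show "\<beta> = closest_point ?C 0" if "\<beta> \<in> ?C \<and> (\<forall>\<gamma>\<in>?C. norm \<beta> \<le> norm \<gamma>)" for \<beta>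
      using closest_point_unique[OF C(2,1), of \<beta> 0] that by simp
  qed
qed

lemma finite_\<beta>min: "finite (\<beta>min ` A)"
proof -
  have "\<beta>min ` A \<subseteq> (\<lambda>C. THE \<beta>. \<beta> \<in> convex hull C \<and> (\<forall>\<gamma> \<in> convex hull C. norm \<beta> \<le> norm \<gamma>))
      ` Pow (range (\<lambda>(i,j,k). \<alpha> i j k))"
    by (intro image_subsetI image_eqI[where x = "weights _"])
      (auto simp: \<beta>min_def dest: weights_subset[THEN subsetD])
  then show ?thesis
    by (rule finite_subset) simp
qed

definition S :: "'n::{finite,linorder} mat \<Rightarrow> 'n bil set" where
  "S \<beta> = {\<mu> \<in> V. \<mu> \<noteq> (\<lambda>X Y. 0) \<and> \<beta> \<in> \<beta>min ` orbit \<mu> \<and> (\<forall>\<gamma> \<in> \<beta>min ` orbit \<mu>. norm \<gamma> \<le> norm \<beta>)}"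

definition W :: "'n::{finite,linorder} mat \<Rightarrow> 'n bil set" where
  "W \<beta> = {\<mu> \<in> V. \<forall>i j k. i < j \<and> sc \<mu> i j k \<noteq> 0 \<longrightarrow> \<beta> \<bullet> \<alpha> i j k \<ge> (norm \<beta>)\<^sup>2}"

end

theory Submission
  imports Defs
begin

text \<open>
  The scaled operator \<open>4/\<parallel>\<mu>\<parallel>\<^sup>2 Ric\<^sub>\<mu>\<close> has \<open>F \<mu>\<close> as its squared norm. Its diagonal part is an average of the
  weights of \<open>\<mu>\<close>, with coefficients proportional to the squares of the structure constants, so it lies in the
  convex hull of the weights (\<open>p_t_scaled_Ric\<close>, \<open>weighted_average_in_hull\<close>). Since an orthogonal projection does
  not increase norms, \<open>F \<mu> \<ge> \<parallel>\<beta>\<^sub>\<mu>\<parallel>\<^sup>2\<close> (\<open>F_ge_\<beta>min\<close>).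

  Everything else rests on the stronger bound \<open>F \<mu> \<ge> \<parallel>\<beta>\<parallel>\<^sup>2\<close> for \<open>\<beta> = \<beta>\<^bsub>g.\<mu>\<^esub>\<close> and every invertible \<open>g\<close>
  (\<open>F_ge_\<beta>min_act\<close>). By the minimality of \<open>\<beta>\<close>, the map \<open>g.\<mu>\<close> lies in \<open>W \<beta>\<close>. The space \<open>W \<beta>\<close> is stable under the
  parabolic group of all invertible \<open>b\<close> that preserve the flag of \<open>\<beta>\<close>, that is, the sums of eigenspaces of \<open>\<beta>\<close>
  with eigenvalue at least \<open>c\<close>: membership in \<open>W \<beta>\<close> says that \<open>\<mu>\<close> maps the flag spaces of levels \<open>c\<close> and \<open>d\<close> into the one of
  level \<open>c + d + \<parallel>\<beta>\<parallel>\<^sup>2\<close> (\<open>mem_W_iff_flag\<close>). Gram-Schmidt orthogonalisation gives such a \<open>b\<close> for which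
  \<open>k = b g\<close> is orthogonal (\<open>orthogonal_times_triangular\<close>). Then \<open>k.\<mu>\<close> is in \<open>W \<beta>\<close>, so the hull of its weights
  lies in the set where \<open>\<langle>\<beta>, \<gamma>\<rangle> \<ge> \<parallel>\<beta>\<parallel>\<^sup>2\<close>, and its shortest vector \<open>\<beta>\<^bsub>k.\<mu>\<^esub>\<close> has norm at least \<open>\<parallel>\<beta>\<parallel>\<close>. As \<open>F\<close> is invariant under the orthogonal group
  (\<open>F_act_orthogonal\<close>), the first bound for \<open>k.\<mu>\<close> yields \<open>F \<mu> = F (k.\<mu>) \<ge> \<parallel>\<beta>\<parallel>\<^sup>2\<close>.

  The bound for \<open>S \<beta>\<close> is an instance. If \<open>\<mu> \<in> W \<beta>\<close> and the infimum of \<open>F\<close> over the orbit is \<open>\<parallel>\<beta>\<parallel>\<^sup>2\<close>, then no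
  \<open>\<beta>\<^bsub>g.\<mu>\<^esub>\<close> is longer than \<open>\<beta>\<close>, while \<open>\<langle>\<beta>, \<beta>\<^sub>\<mu>\<rangle> \<ge> \<parallel>\<beta>\<parallel>\<^sup>2\<close>; both together force \<open>\<beta>\<^sub>\<mu> = \<beta>\<close>, so the maximum of the norm is
  attained at \<open>\<beta>\<close> (\<open>S_of_Inf_F\<close>). For the sorted representative, a permutation matrix moves \<open>\<mu> \<in> W \<beta>\<^sub>\<mu>\<close> into
  \<open>W \<beta>\<close> for the sorted \<open>\<beta>\<close>, and the previous case applies at that point of the same orbit.
\<close>

section \<open>The diagonal part of the Ricci operator\<close>

lemma e_nth: "e i $ j = (if j = i then 1 else 0 :: real)"
  by (simp add: axis_def)

lemma sc_nth: "sc \<mu> i j k = \<mu> (e i) (e j) $ k"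
  by (simp add: sc_def inner_axis)

lemma sum_inner_axes: fixes x y :: "real ^ 'n::finite"
  shows "(\<Sum>j\<in>UNIV. (x \<bullet> e j) * (y \<bullet> e j)) = x \<bullet> y"
  by (simp add: inner_axis) (simp add: inner_vec_def)

lemma V_bilinear: "\<mu> \<in> V \<Longrightarrow> bilinear \<mu>"
  by (simp add: V_def)

lemma V_skew: "\<mu> \<in> V \<Longrightarrow> \<mu> X Y = - \<mu> Y X"
  unfolding V_def by blast

lemma sc_skew: "\<mu> \<in> V \<Longrightarrow> sc \<mu> j i k = - sc \<mu> i j k"
  unfolding sc_def by (subst V_skew) simp_all

text \<open>
  The structure constants are indexed by pairs \<open>i < j\<close> in sums over weights, but by all pairs in the norm and
  in \<open>Ric\<close>; this converts between the two conventions.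
\<close>

lemma sum_increasing_pairs:
  fixes f :: "'n::{finite,linorder} \<Rightarrow> 'n \<Rightarrow> 'n \<Rightarrow> real"
  assumes sym: "\<And>i j k. f j i k = f i j k" and diag: "\<And>i k. f i i k = 0"
  shows "(\<Sum>(i,j,k)\<in>{(i,j,k). i < j}. f i j k) = (\<Sum>i\<in>UNIV. \<Sum>j\<in>UNIV. \<Sum>k\<in>UNIV. f i j k) / 2"
proof -
  let ?g = "\<lambda>i j k. if i < j then f i j k else 0"
  have "(\<Sum>(i,j,k)\<in>{(i,j,k). i < j}. f i j k) = (\<Sum>(i,j,k)\<in>UNIV. ?g i j k)"
    by (rule sum.mono_neutral_cong_left) (auto split: if_splits)
  also have "\<dots> = (\<Sum>i\<in>UNIV. \<Sum>j\<in>UNIV. \<Sum>k\<in>UNIV. ?g i j k)"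
    by (simp add: sum.cartesian_product)
  finally have lt: "(\<Sum>(i,j,k)\<in>{(i,j,k). i < j}. f i j k) = (\<Sum>i\<in>UNIV. \<Sum>j\<in>UNIV. \<Sum>k\<in>UNIV. ?g i j k)" .
  have "(\<Sum>i\<in>UNIV. \<Sum>j\<in>UNIV. \<Sum>k\<in>UNIV. f i j k)
      = (\<Sum>i\<in>UNIV. \<Sum>j\<in>UNIV. \<Sum>k\<in>UNIV. ?g i j k + ?g j i k)"
  proof (intro sum.cong refl)
    fix i j k show "f i j k = ?g i j k + ?g j i k"
      using sym[of j i k] diag[of i k] by (cases i j rule: linorder_cases) auto
  qed
  also have "\<dots> = (\<Sum>i\<in>UNIV. \<Sum>j\<in>UNIV. \<Sum>k\<in>UNIV. ?g i j k) + (\<Sum>i\<in>UNIV. \<Sum>j\<in>UNIV. \<Sum>k\<in>UNIV. ?g j i k)"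
    by (simp only: sum.distrib)
  also have "(\<Sum>i\<in>UNIV. \<Sum>j\<in>UNIV. \<Sum>k\<in>UNIV. ?g j i k) = (\<Sum>i\<in>UNIV. \<Sum>j\<in>UNIV. \<Sum>k\<in>UNIV. ?g i j k)"
    by (rule sum.swap)
  finally show ?thesis using lt by simp
qed

lemma normV_sq: "(normV \<mu>)\<^sup>2 = (\<Sum>i\<in>UNIV. \<Sum>j\<in>UNIV. \<Sum>k\<in>UNIV. (sc \<mu> i j k)\<^sup>2)"
proof -
  have "innerV \<mu> \<mu> = (\<Sum>i\<in>UNIV. \<Sum>j\<in>UNIV. \<Sum>k\<in>UNIV. (sc \<mu> i j k)\<^sup>2)"
    by (simp add: innerV_def sc_def power2_eq_square)
  moreover have "\<dots> \<ge> 0" by (intro sum_nonneg) simp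
  ultimately show ?thesis by (simp add: normV_def)
qed

lemma normV_sq_increasing:
  fixes \<mu> :: "'n::{finite,linorder} bil"
  assumes "\<mu> \<in> V"
  shows "(normV \<mu>)\<^sup>2 = 2 * (\<Sum>(i,j,k)\<in>{(i,j,k). i < j}. (sc \<mu> i j k)\<^sup>2)"
proof -
  have sym: "(sc \<mu> j i k)\<^sup>2 = (sc \<mu> i j k)\<^sup>2" for i j k
    using sc_skew[OF assms, of i j k] by simp
  have zero: "sc \<mu> i i k = 0" for i k
    using sc_skew[OF assms, of i i k] by simp
  show ?thesis
    using sum_increasing_pairs[of "\<lambda>i j k. (sc \<mu> i j k)\<^sup>2", OF sym] by (simp add: normV_sq zero)
qed

lemma normV_pos:
  fixes \<mu> :: "'n::{finite,linorder} bil"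
  assumes "\<mu> \<in> V" "\<mu> \<noteq> (\<lambda>X Y. 0)"
  shows "(normV \<mu>)\<^sup>2 > 0"
proof -
  obtain i j k where ijk: "i < j" "sc \<mu> i j k \<noteq> 0"
    using weights_nonempty[OF assms] by (auto simp: weights_def)
  have "0 < (\<Sum>(i,j,k)\<in>{(i,j,k). i < j}. (sc \<mu> i j k)\<^sup>2)"
    using ijk by (intro sum_pos2[where i = "(i,j,k)"]) auto
  then show ?thesis by (simp add: normV_sq_increasing[OF assms(1)])
qed

lemma \<alpha>_nth: "\<alpha> i j k $ r $ s = (if r = s then of_bool (k = r) - of_bool (i = r) - of_bool (j = r) else 0)"
  by (auto simp: \<alpha>_def E_def)

lemma inner_\<alpha>: "A \<bullet> \<alpha> i j k = A $ k $ k - A $ i $ i - A $ j $ j"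
proof -
  have "A \<bullet> E r r = A $ r $ r" for r
  proof -
    have "E r r = axis r (axis r 1)" by (simp add: E_def axis_def vec_eq_iff)
    then show ?thesis by (simp add: inner_axis)
  qed
  then show ?thesis by (simp add: \<alpha>_def inner_diff_right)
qed

text \<open>
  In the sum over all \<open>i\<close> and \<open>j\<close>, the term \<open>E k k\<close> of \<open>\<alpha> i j k\<close> produces the positive part of the diagonal of
  \<open>Ric\<close>, and the terms \<open>E i i\<close> and \<open>E j j\<close>, equal by skew-symmetry, produce the negative part.
\<close>

lemma p_t_Ric:
  fixes \<mu> :: "'n::{finite,linorder} bil"
  assumes "\<mu> \<in> V"
  shows "p_t (Ric \<mu>) = (1/2) *\<^sub>R (\<Sum>(i,j,k)\<in>{(i,j,k). i < j}. (sc \<mu> i j k)\<^sup>2 *\<^sub>R \<alpha> i j k)"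
proof -
  let ?c = "\<lambda>i j k. (sc \<mu> i j k)\<^sup>2"
  have sym: "?c j i k = ?c i j k" for i j k
    using sc_skew[OF assms, of i j k] by simp
  have zero: "sc \<mu> i i k = 0" for i k
    using sc_skew[OF assms, of i i k] by simp
  have diag: "Ric \<mu> $ r $ r = - (1/2) * (\<Sum>i\<in>UNIV. \<Sum>k\<in>UNIV. ?c r i k) + (1/4) * (\<Sum>i\<in>UNIV. \<Sum>j\<in>UNIV. ?c i j r)" for r
    by (simp add: Ric_def ric_form_def sc_def power2_eq_square)
  have entry: "(\<Sum>(i,j,k)\<in>{(i,j,k). i < j}. ?c i j k *\<^sub>R \<alpha> i j k) $ r $ s = 
     (if r = s then 2 * Ric \<mu> $ r $ r else 0)" for r s
  proof (cases "r = s")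
    case True
    let ?f = "\<lambda>i j k. ?c i j k * (of_bool (k = r) - of_bool (i = r) - of_bool (j = r))"
    have k: "(\<Sum>i\<in>UNIV. \<Sum>j\<in>UNIV. \<Sum>k\<in>UNIV. ?c i j k * of_bool (k = r)) = (\<Sum>i\<in>UNIV. \<Sum>j\<in>UNIV. ?c i j r)"
      by (simp add: of_bool_def if_distrib cong: if_cong)
    have "(\<Sum>i\<in>UNIV. \<Sum>j\<in>UNIV. \<Sum>k\<in>UNIV. ?c i j k * of_bool (i = r))
        = (\<Sum>i\<in>UNIV. if i = r then \<Sum>j\<in>UNIV. \<Sum>k\<in>UNIV. ?c i j k else 0)"
      by (intro sum.cong) auto
    then have i: "(\<Sum>i\<in>UNIV. \<Sum>j\<in>UNIV. \<Sum>k\<in>UNIV. ?c i j k * of_bool (i = r)) = (\<Sum>j\<in>UNIV. \<Sum>k\<in>UNIV. ?c r j k)"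
      by simp
    have "(\<Sum>i\<in>UNIV. \<Sum>j\<in>UNIV. \<Sum>k\<in>UNIV. ?c i j k * of_bool (j = r))
        = (\<Sum>i\<in>UNIV. \<Sum>j\<in>UNIV. if j = r then \<Sum>k\<in>UNIV. ?c i j k else 0)"
      by (intro sum.cong) auto
    then have "(\<Sum>i\<in>UNIV. \<Sum>j\<in>UNIV. \<Sum>k\<in>UNIV. ?c i j k * of_bool (j = r)) = (\<Sum>i\<in>UNIV. \<Sum>k\<in>UNIV. ?c i r k)"
      by simp
    then have j: "(\<Sum>i\<in>UNIV. \<Sum>j\<in>UNIV. \<Sum>k\<in>UNIV. ?c i j k * of_bool (j = r)) = (\<Sum>j\<in>UNIV. \<Sum>k\<in>UNIV. ?c r j k)"
      by (simp only: sym[of r])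
    have "(\<Sum>(i,j,k)\<in>{(i,j,k). i < j}. ?c i j k *\<^sub>R \<alpha> i j k) $ r $ s = (\<Sum>(i,j,k)\<in>{(i,j,k). i < j}. ?f i j k)"
      by (auto simp: sum_component \<alpha>_nth True intro!: sum.cong)
    also have "\<dots> = (\<Sum>i\<in>UNIV. \<Sum>j\<in>UNIV. \<Sum>k\<in>UNIV. ?f i j k) / 2"
    proof (rule sum_increasing_pairs)
      show "?f j i k = ?f i j k" for i j k using sym[of j i k] by (simp add: algebra_simps)
    qed (simp add: zero)
    also have "\<dots> = 2 * Ric \<mu> $ r $ r"
      unfolding diag right_diff_distrib sum_subtractf k i j by (simp add: field_simps)
    finally show ?thesis using True by simp
  qed (auto simp: sum_component \<alpha>_nth intro!: sum.neutral)
  show ?thesis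
    using entry by (simp add: vec_eq_iff p_t_def del: sum_component)
qed

text \<open>
  The coefficients are nonnegative, and they add up to one because \<open>\<parallel>\<mu>\<parallel>\<^sup>2\<close> counts every pair \<open>i < j\<close> twice.
\<close>

lemma weighted_average_in_hull:
  fixes \<mu> :: "'n::{finite,linorder} bil"
  assumes "\<mu> \<in> V" "\<mu> \<noteq> (\<lambda>X Y. 0)"
  shows "(2 / (normV \<mu>)\<^sup>2) *\<^sub>R (\<Sum>(i,j,k)\<in>{(i,j,k). i < j}. (sc \<mu> i j k)\<^sup>2 *\<^sub>R \<alpha> i j k)
       \<in> convex hull (weights \<mu>)"
proof -
  let ?N = "(normV \<mu>)\<^sup>2" and ?I = "{(i,j,k). i < j \<and> sc \<mu> i j k \<noteq> 0}"
  let ?w = "\<lambda>(i,j,k). 2 / ?N * (sc \<mu> i j k)\<^sup>2"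
  have "(\<Sum>x\<in>?I. ?w x *\<^sub>R (case x of (i,j,k) \<Rightarrow> \<alpha> i j k)) \<in> convex hull (weights \<mu>)"
  proof (rule convex_sum)
    have "(\<Sum>x\<in>?I. ?w x) = 2 / ?N * (\<Sum>(i,j,k)\<in>?I. (sc \<mu> i j k)\<^sup>2)"
      by (simp add: sum_distrib_left case_prod_beta)
    also have "(\<Sum>(i,j,k)\<in>?I. (sc \<mu> i j k)\<^sup>2) = (\<Sum>(i,j,k)\<in>{(i,j,k). i < j}. (sc \<mu> i j k)\<^sup>2)"
      by (rule sum.mono_neutral_left) auto
    also have "2 / ?N * \<dots> = 1"
      using normV_pos[OF assms] by (simp add: normV_sq_increasing[OF assms(1)])
    finally show "(\<Sum>x\<in>?I. ?w x) = 1" .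
    show "(case x of (i,j,k) \<Rightarrow> \<alpha> i j k) \<in> convex hull (weights \<mu>)" if "x \<in> ?I" for x
      using that by (intro hull_inc) (auto simp: weights_def)
  qed auto
  also have "(\<Sum>x\<in>?I. ?w x *\<^sub>R (case x of (i,j,k) \<Rightarrow> \<alpha> i j k))
      = (\<Sum>(i,j,k)\<in>?I. (2 / ?N) *\<^sub>R (sc \<mu> i j k)\<^sup>2 *\<^sub>R \<alpha> i j k)"
    by (auto intro!: sum.cong)
  also have "\<dots> = (\<Sum>(i,j,k)\<in>{(i,j,k). i < j}. (2 / ?N) *\<^sub>R (sc \<mu> i j k)\<^sup>2 *\<^sub>R \<alpha> i j k)"
    by (rule sum.mono_neutral_left) auto
  also have "\<dots> = (2 / ?N) *\<^sub>R (\<Sum>(i,j,k)\<in>{(i,j,k). i < j}. (sc \<mu> i j k)\<^sup>2 *\<^sub>R \<alpha> i j k)"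
    by (simp add: scaleR_sum_right case_prod_beta)
  finally show ?thesis .
qed

lemma norm_p_t_le: "norm (p_t A) \<le> norm A"
proof (rule power2_le_imp_le)
  have "A \<bullet> A = (p_t A + (A - p_t A)) \<bullet> (p_t A + (A - p_t A))" by simp
  also have "\<dots> = p_t A \<bullet> p_t A + (A - p_t A) \<bullet> (A - p_t A)"
    unfolding inner_add_left inner_add_right
    using p_t_orthogonal_projection(2)[OF p_t_orthogonal_projection(1), of A A]
    by (simp add: inner_commute)
  finally show "(norm (p_t A))\<^sup>2 \<le> (norm A)\<^sup>2"
    by (simp add: power2_norm_eq_inner)
qed simp

lemma F_eq_norm: "F \<mu> = (norm ((4 / (normV \<mu>)\<^sup>2) *\<^sub>R Ric \<mu>))\<^sup>2"
proof -
  have "trace (Ric \<mu> ** Ric \<mu>) = (norm (Ric \<mu>))\<^sup>2"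
    by (simp add: power2_norm_eq_inner inner_matrix_eq_trace Ric_symmetric)
  then show ?thesis by (simp add: F_def power_mult_distrib power_divide)
qed

lemma \<beta>min:
  fixes \<mu> :: "'n::{finite,linorder} bil"
  assumes "\<mu> \<in> V" "\<mu> \<noteq> (\<lambda>X Y. 0)"
  shows \<beta>min_in_hull: "\<beta>min \<mu> \<in> convex hull (weights \<mu>)"
    and \<beta>min_le: "\<gamma> \<in> convex hull (weights \<mu>) \<Longrightarrow> norm (\<beta>min \<mu>) \<le> norm \<gamma>"
  using theI'[OF \<beta>min_ex1[OF assms]] unfolding \<beta>min_def[symmetric] by blast+

lemma p_t_scaled_Ric:
  fixes \<mu> :: "'n::{finite,linorder} bil"
  assumes "\<mu> \<in> V"
  shows "p_t ((4 / (normV \<mu>)\<^sup>2) *\<^sub>R Ric \<mu>)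
       = (2 / (normV \<mu>)\<^sup>2) *\<^sub>R (\<Sum>(i,j,k)\<in>{(i,j,k). i < j}. (sc \<mu> i j k)\<^sup>2 *\<^sub>R \<alpha> i j k)"
proof -
  have "p_t (c *\<^sub>R A) = c *\<^sub>R p_t A" for c and A :: "'n mat"
    by (simp add: p_t_def vec_eq_iff)
  then show ?thesis by (simp add: p_t_Ric[OF assms])
qed

text \<open>
  The projection \<open>p_t\<close> of the scaled Ricci operator is at most as long as the operator and, as a point of the
  hull, at least as long as \<open>\<beta>min \<mu>\<close>.
\<close>

lemma F_ge_\<beta>min:
  fixes \<mu> :: "'n::{finite,linorder} bil"
  assumes "\<mu> \<in> V" "\<mu> \<noteq> (\<lambda>X Y. 0)"
  shows "F \<mu> \<ge> (norm (\<beta>min \<mu>))\<^sup>2"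
proof -
  have "norm (\<beta>min \<mu>) \<le> norm (p_t ((4 / (normV \<mu>)\<^sup>2) *\<^sub>R Ric \<mu>))"
    using weighted_average_in_hull[OF assms] unfolding p_t_scaled_Ric[OF assms(1)] by (rule \<beta>min_le[OF assms])
  also have "\<dots> \<le> norm ((4 / (normV \<mu>)\<^sup>2) *\<^sub>R Ric \<mu>)" by (rule norm_p_t_le)
  finally show ?thesis unfolding F_eq_norm by (rule power_mono) simp
qed

section \<open>The action of the general linear group\<close>

lemma
  assumes "g \<in> GL"
  shows GL_right_inverse: "g ** matrix_inv g = mat 1" and GL_left_inverse: "matrix_inv g ** g = mat 1"
proof -
  have "\<exists>h. g ** h = mat 1 \<and> h ** g = mat 1" using assms by (simp add: GL_def invertible_def)
  from someI_ex[OF this] show "g ** matrix_inv g = mat 1" "matrix_inv g ** g = mat 1"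
    by (simp_all add: matrix_inv_def)
qed

lemma
  assumes "g \<in> GL"
  shows GL_cancel_left: "matrix_inv g *v (g *v X) = X" and GL_cancel_right: "g *v (matrix_inv g *v X) = X"
  by (simp_all add: matrix_vector_mul_assoc GL_left_inverse[OF assms] GL_right_inverse[OF assms])

lemma GL_mult: "g \<in> GL \<Longrightarrow> h \<in> GL \<Longrightarrow> g ** h \<in> GL"
  by (simp add: GL_def invertible_mult)

lemma GL_one: "mat 1 \<in> GL"
  unfolding GL_def invertible_def by (auto intro: exI[of _ "mat 1"])

lemma matrix_inv_unique:
  fixes g h :: "'n::finite mat"
  assumes "g ** h = mat 1"
  shows "g \<in> GL" "matrix_inv g = h"
proof -
  show g: "g \<in> GL"
    using assms by (auto simp: GL_def invertible_right_inverse)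
  have "matrix_inv g = matrix_inv g ** (g ** h)" by (simp add: assms)
  also have "\<dots> = h" by (simp add: matrix_mul_assoc GL_left_inverse[OF g])
  finally show "matrix_inv g = h" .
qed

lemma GL_inverse: "g \<in> GL \<Longrightarrow> matrix_inv g \<in> GL"
  using matrix_inv_unique(1)[OF GL_left_inverse] .

lemma matrix_inv_mult:
  fixes g h :: "'n::finite mat"
  assumes "g \<in> GL" "h \<in> GL"
  shows "matrix_inv (g ** h) = matrix_inv h ** matrix_inv g"
proof (rule matrix_inv_unique)
  have "(g ** h) ** (matrix_inv h ** matrix_inv g) = g ** (h ** matrix_inv h) ** matrix_inv g"
    by (simp only: matrix_mul_assoc)
  then show "(g ** h) ** (matrix_inv h ** matrix_inv g) = mat 1"
    by (simp add: GL_right_inverse assms)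
qed

lemma
  fixes k :: "'n::finite mat"
  assumes "orthogonal_matrix k"
  shows orthogonal_GL: "k \<in> GL" and orthogonal_matrix_inv: "matrix_inv k = transpose k"
  using matrix_inv_unique[of k "transpose k"] assms by (simp_all add: orthogonal_matrix_def)

lemma V_linear:
  assumes "\<mu> \<in> V"
  shows "linear (\<mu> X)" "linear (\<lambda>X. \<mu> X Y)"
  using V_bilinear[OF assms] by (auto simp: bilinear_def)

lemma act_V:
  assumes "\<mu> \<in> V"
  shows "act g \<mu> \<in> V"
proof -
  have "linear (act g \<mu> X)" "linear (\<lambda>X. act g \<mu> X Y)" for X Y
    using linear_compose[OF linear_compose[OF matrix_vector_mul_linear V_linear(1)[OF assms]] matrix_vector_mul_linear]
      linear_compose[OF linear_compose[OF matrix_vector_mul_linear V_linear(2)[OF assms]] matrix_vector_mul_linear]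
    by (simp_all add: o_def act_def[abs_def])
  moreover have "act g \<mu> X Y = - act g \<mu> Y X" for X Y
    unfolding act_def by (subst V_skew[OF assms]) (rule linear_neg[OF matrix_vector_mul_linear])
  ultimately show ?thesis unfolding V_def bilinear_def by blast
qed

lemma act_act: "g \<in> GL \<Longrightarrow> h \<in> GL \<Longrightarrow> act g (act h \<mu>) = act (g ** h) \<mu>"
  by (simp add: act_def matrix_inv_mult matrix_vector_mul_assoc)

lemma act_one:
  fixes \<mu> :: "'n::finite bil"
  shows "act (mat 1) \<mu> = \<mu>"
  using matrix_inv_unique(2)[of "mat 1" "mat 1 :: 'n mat"] by (simp add: act_def)

lemma act_inverse_act: "g \<in> GL \<Longrightarrow> act (matrix_inv g) (act g \<mu>) = \<mu>"
  by (simp add: act_act GL_inverse GL_left_inverse act_one)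

lemma act_nonzero:
  assumes "g \<in> GL" "\<mu> \<noteq> (\<lambda>X Y. 0)"
  shows "act g \<mu> \<noteq> (\<lambda>X Y. 0)"
proof
  assume "act g \<mu> = (\<lambda>X Y. 0)"
  then have "act (matrix_inv g) (act g \<mu>) = (\<lambda>X Y. 0)" by (simp add: act_def)
  then show False using assms by (simp add: act_inverse_act)
qed

lemma orbit_act_subset: "g \<in> GL \<Longrightarrow> orbit (act g \<mu>) \<subseteq> orbit \<mu>"
  by (auto simp: orbit_def act_act intro: GL_mult)

text \<open>
  Orbits partition \<open>V\<close>: this is what lets the infimum of \<open>F\<close> and the property of lying in \<open>S \<beta>\<close> be moved
  from one point of an orbit to another.
\<close>

lemma orbit_act: "g \<in> GL \<Longrightarrow> orbit (act g \<mu>) = orbit \<mu>"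
  using orbit_act_subset[of g \<mu>] orbit_act_subset[of "matrix_inv g" "act g \<mu>"]
  by (auto simp: GL_inverse act_inverse_act)

section \<open>Orthogonal invariance of F\<close>

text \<open>
  The trace of a bilinear map does not depend on the orthonormal basis. The rows of \<open>k\<close>, which are the vectors
  \<open>transpose k *v e i\<close>, form such a basis.
\<close>

lemma sum_over_orthonormal_basis:
  fixes q :: "real ^ 'n::finite \<Rightarrow> real ^ 'n \<Rightarrow> 'b::real_vector"
  assumes q: "bilinear q" and k: "orthogonal_matrix k"
  shows "(\<Sum>i\<in>UNIV. q (transpose k *v e i) (transpose k *v e i)) = (\<Sum>i\<in>UNIV. q (e i) (e i))"
proof -
  have basis: "transpose k *v e i = (\<Sum>l\<in>UNIV. k $ i $ l *\<^sub>R e l)" for i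
    by (simp add: vec_eq_iff matrix_vector_mult_def transpose_def axis_def if_distrib cong: if_cong)
  have "transpose k ** k = mat 1" using k by (simp add: orthogonal_matrix_def)
  then have orth: "(\<Sum>i\<in>UNIV. k $ i $ l * k $ i $ m) = (if l = m then 1 else 0)" for l m
    by (simp add: vec_eq_iff matrix_matrix_mult_def transpose_def mat_def)
  have "(\<Sum>i\<in>UNIV. q (transpose k *v e i) (transpose k *v e i))
      = (\<Sum>i\<in>UNIV. \<Sum>l\<in>UNIV. \<Sum>m\<in>UNIV. (k $ i $ l * k $ i $ m) *\<^sub>R q (e l) (e m))"
    unfolding basis bilinear_sum[OF q]
    by (simp add: sum.cartesian_product bilinear_lmul[OF q] bilinear_rmul[OF q] case_prod_beta mult.commute)
  also have "\<dots> = (\<Sum>l\<in>UNIV. \<Sum>i\<in>UNIV. \<Sum>m\<in>UNIV. (k $ i $ l * k $ i $ m) *\<^sub>R q (e l) (e m))"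
    by (rule sum.swap)
  also have "\<dots> = (\<Sum>l\<in>UNIV. \<Sum>m\<in>UNIV. \<Sum>i\<in>UNIV. (k $ i $ l * k $ i $ m) *\<^sub>R q (e l) (e m))"
    by (intro sum.cong refl sum.swap)
  also have "\<dots> = (\<Sum>l\<in>UNIV. q (e l) (e l))"
    by (simp add: orth if_distrib[of "\<lambda>c. c *\<^sub>R _"] flip: scaleR_sum_left cong: if_cong)
  finally show ?thesis .
qed

lemma
  fixes k :: "'n::finite mat"
  assumes "orthogonal_matrix k"
  shows orthogonal_inner: "(k *v X) \<bullet> (k *v Y) = X \<bullet> Y"
    and orthogonal_inner_transpose: "(k *v X) \<bullet> Y = X \<bullet> (transpose k *v Y)"
proof -
  show adj: "(k *v X) \<bullet> Y = X \<bullet> (transpose k *v Y)" for X Y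
    by (metis dot_lmul_matrix transpose_transpose vector_transpose_matrix)
  show "(k *v X) \<bullet> (k *v Y) = X \<bullet> Y"
    using assms by (simp add: adj matrix_vector_mul_assoc orthogonal_matrix_def)
qed

lemma bilinear_inner_bilinear:
  assumes "linear f" "linear g"
  shows "bilinear (\<lambda>X Y. (f X :: 'b::real_inner) \<bullet> g Y)"
  unfolding bilinear_def
  by (auto intro!: linearI simp: linear_add[OF assms(1)] linear_add[OF assms(2)]
      linear_scale[OF assms(1)] linear_scale[OF assms(2)] inner_add_left inner_add_right)

text \<open>
  Both sums in the Ricci form are traces of bilinear maps, so replacing the standard basis by its image under
  \<open>transpose k\<close> changes nothing but the two arguments.
\<close>

lemma ric_form_act:
  fixes \<mu> :: "'n::finite bil"
  assumes \<mu>: "\<mu> \<in> V" and k: "orthogonal_matrix k"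
  shows "ric_form (act k \<mu>) X Y = ric_form \<mu> (transpose k *v X) (transpose k *v Y)"
proof -
  let ?k = "\<lambda>X. transpose k *v X"
  have "(\<Sum>i\<in>UNIV. \<mu> (?k X) (?k (e i)) \<bullet> \<mu> (?k Y) (?k (e i))) = (\<Sum>i\<in>UNIV. \<mu> (?k X) (e i) \<bullet> \<mu> (?k Y) (e i))"
    by (rule sum_over_orthonormal_basis[OF bilinear_inner_bilinear k, OF V_linear(1)[OF \<mu>] V_linear(1)[OF \<mu>]])
  then have first: "(\<Sum>i\<in>UNIV. \<Sum>j\<in>UNIV. (act k \<mu> X (e i) \<bullet> e j) * (act k \<mu> Y (e i) \<bullet> e j))
     = (\<Sum>i\<in>UNIV. \<Sum>j\<in>UNIV. (\<mu> (?k X) (e i) \<bullet> e j) * (\<mu> (?k Y) (e i) \<bullet> e j))"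
    by (simp add: sum_inner_axes act_def orthogonal_matrix_inv[OF k] orthogonal_inner[OF k])
  let ?q = "\<lambda>A B. (\<mu> A B \<bullet> ?k X) * (\<mu> A B \<bullet> ?k Y)"
  have lin: "linear (\<lambda>A. \<mu> A B \<bullet> Z)" "linear (\<lambda>B. \<mu> A B \<bullet> Z)" for A B Z
    using linear_compose[OF V_linear(1)[OF \<mu>] bounded_linear.linear[OF bounded_linear_inner_left]]
      linear_compose[OF V_linear(2)[OF \<mu>] bounded_linear.linear[OF bounded_linear_inner_left]]
    by (simp_all add: o_def)
  have "(\<Sum>i\<in>UNIV. \<Sum>j\<in>UNIV. ?q (?k (e i)) (?k (e j))) = (\<Sum>i\<in>UNIV. \<Sum>j\<in>UNIV. ?q (?k (e i)) (e j))"
    using sum_over_orthonormal_basis[OF bilinear_inner_bilinear k, OF lin(2) lin(2)] by simp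
  also have "\<dots> = (\<Sum>j\<in>UNIV. \<Sum>i\<in>UNIV. ?q (?k (e i)) (e j))" by (rule sum.swap)
  also have "\<dots> = (\<Sum>j\<in>UNIV. \<Sum>i\<in>UNIV. ?q (e i) (e j))"
    using sum_over_orthonormal_basis[OF bilinear_inner_bilinear k, OF lin(1) lin(1)] by simp
  also have "\<dots> = (\<Sum>i\<in>UNIV. \<Sum>j\<in>UNIV. ?q (e i) (e j))" by (rule sum.swap)
  finally have second: "(\<Sum>i\<in>UNIV. \<Sum>j\<in>UNIV. (act k \<mu> (e i) (e j) \<bullet> X) * (act k \<mu> (e i) (e j) \<bullet> Y))
      = (\<Sum>i\<in>UNIV. \<Sum>j\<in>UNIV. ?q (e i) (e j))"
    by (simp add: act_def orthogonal_matrix_inv[OF k] orthogonal_inner_transpose[OF k])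
  show ?thesis unfolding ric_form_def first second ..
qed

lemma Ric_act:
  fixes \<mu> :: "'n::finite bil"
  assumes \<mu>: "\<mu> \<in> V" and k: "orthogonal_matrix k"
  shows "Ric (act k \<mu>) = k ** Ric \<mu> ** transpose k"
proof -
  have "Ric (act k \<mu>) *v X = (k ** Ric \<mu> ** transpose k) *v X" for X
  proof (rule vector_eq_rdot[THEN iffD1], rule allI)
    fix Y
    have "(Ric (act k \<mu>) *v X) \<bullet> Y = (Ric \<mu> *v (transpose k *v X)) \<bullet> (transpose k *v Y)"
      by (simp add: Ric_inner[OF \<mu>] Ric_inner[OF act_V[OF \<mu>]] ric_form_act[OF \<mu> k])
    also have "\<dots> = (k *v (Ric \<mu> *v (transpose k *v X))) \<bullet> Y"
      by (simp add: orthogonal_inner_transpose[OF k])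
    finally show "(Ric (act k \<mu>) *v X) \<bullet> Y = ((k ** Ric \<mu> ** transpose k) *v X) \<bullet> Y"
      by (simp only: matrix_vector_mul_assoc matrix_mul_assoc)
  qed
  then show ?thesis by (simp add: matrix_eq)
qed

lemma innerV_act:
  fixes \<mu> :: "'n::finite bil"
  assumes \<mu>: "\<mu> \<in> V" and k: "orthogonal_matrix k"
  shows "innerV (act k \<mu>) (act k \<mu>) = innerV \<mu> \<mu>"
proof -
  let ?k = "\<lambda>X. transpose k *v X"
  let ?q = "\<lambda>A B. \<mu> A B \<bullet> \<mu> A B"
  have "innerV (act k \<mu>) (act k \<mu>) = (\<Sum>i\<in>UNIV. \<Sum>j\<in>UNIV. ?q (?k (e i)) (?k (e j)))"
    by (simp add: innerV_def sum_inner_axes act_def orthogonal_matrix_inv[OF k] orthogonal_inner[OF k])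
  also have "\<dots> = (\<Sum>i\<in>UNIV. \<Sum>j\<in>UNIV. ?q (?k (e i)) (e j))"
    using sum_over_orthonormal_basis[OF bilinear_inner_bilinear k, OF V_linear(1)[OF \<mu>] V_linear(1)[OF \<mu>]] by simp
  also have "\<dots> = (\<Sum>j\<in>UNIV. \<Sum>i\<in>UNIV. ?q (?k (e i)) (e j))" by (rule sum.swap)
  also have "\<dots> = (\<Sum>j\<in>UNIV. \<Sum>i\<in>UNIV. ?q (e i) (e j))"
    using sum_over_orthonormal_basis[OF bilinear_inner_bilinear k, OF V_linear(2)[OF \<mu>] V_linear(2)[OF \<mu>]] by simp
  also have "\<dots> = (\<Sum>i\<in>UNIV. \<Sum>j\<in>UNIV. ?q (e i) (e j))" by (rule sum.swap)
  also have "\<dots> = innerV \<mu> \<mu>" by (simp add: innerV_def sum_inner_axes)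
  finally show ?thesis .
qed

lemma F_act_orthogonal:
  fixes \<mu> :: "'n::finite bil"
  assumes \<mu>: "\<mu> \<in> V" and k: "orthogonal_matrix k"
  shows "F (act k \<mu>) = F \<mu>"
proof -
  have "trace (Ric (act k \<mu>) ** Ric (act k \<mu>)) = trace (k ** Ric \<mu> ** (transpose k ** k) ** Ric \<mu> ** transpose k)"
    by (simp only: Ric_act[OF assms] matrix_mul_assoc)
  also have "\<dots> = trace (k ** (Ric \<mu> ** Ric \<mu> ** transpose k))"
    using k by (simp add: orthogonal_matrix_def matrix_mul_assoc)
  also have "\<dots> = trace (Ric \<mu> ** Ric \<mu> ** transpose k ** k)"
    by (rule trace_mul_sym)
  also have "\<dots> = trace (Ric \<mu> ** Ric \<mu> ** (transpose k ** k))"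
    by (simp only: matrix_mul_assoc)
  also have "\<dots> = trace (Ric \<mu> ** Ric \<mu>)"
    using k by (simp add: orthogonal_matrix_def)
  finally show ?thesis by (simp add: F_def normV_def innerV_act[OF assms])
qed

section \<open>Flags, orthogonalisation and the spaces W\<close>

text \<open>
  The span of the basis vectors \<open>e i\<close> with \<open>c \<le> a i\<close>: for the diagonal \<open>a\<close> of \<open>\<beta>\<close>, the sum of the eigenspaces of \<open>\<beta>\<close> with
  eigenvalue at least \<open>c\<close>.
\<close>

definition flag :: "('n::finite \<Rightarrow> real) \<Rightarrow> real \<Rightarrow> (real ^ 'n) set" where
  "flag a c = {X. \<forall>i. a i < c \<longrightarrow> X $ i = 0}"

lemma subspace_flag: "subspace (flag a c)"
  by (auto simp: flag_def subspace_def)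

lemma axis_in_flag: "e i \<in> flag a c \<longleftrightarrow> c \<le> a i"
  by (auto simp: flag_def e_nth not_less split: if_splits)

text \<open>
  Gram-Schmidt orthogonalisation of the columns of \<open>h\<close>, taken in decreasing order of \<open>a\<close> with ties broken by the order
  of the indices. The rows of \<open>k\<close> are the normalised components of the columns orthogonal to the span of their
  predecessors. Adapting the order to \<open>a\<close> makes \<open>k ** h\<close> preserve the flag of \<open>a\<close> even if \<open>a\<close> is not sorted.
\<close>

lemma orthogonal_times_triangular:
  fixes h :: "'n::{finite,linorder} mat" and a :: "'n \<Rightarrow> real"
  assumes h: "h \<in> GL"
  obtains k where "orthogonal_matrix k" "\<And>i j. a i < a j \<Longrightarrow> (k ** h) $ i $ j = 0"
proof -
  \<comment> \<open>The tie-breaking makes \<open>lt\<close> a strict total order, so distinct rows of \<open>k\<close> are always comparable.\<close>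
  define lt where "lt i j \<longleftrightarrow> a i < a j \<or> (a i = a j \<and> i < j)" for i j
  have total: "lt i j \<or> lt j i" if "i \<noteq> j" for i j
    using that by (auto simp: lt_def)
  have trans: "lt i l" if "lt i j" "lt j l" for i j l
    using that by (auto simp: lt_def)
  have irrefl: "\<not> lt i i" for i by (simp add: lt_def)
  define f where "f j = h *v e j" for j
  define U where "U i = span (f ` {j. lt i j})" for i
  \<comment> \<open>Applying the inverse of \<open>h\<close> reduces this to the independence of the standard basis.\<close>
  have notin: "f i \<notin> U i" for i
  proof
    assume "f i \<in> U i"
    also have "U i = (*v) h ` span (e ` {j. lt i j})"
      unfolding U_def f_def
      by (simp add: linear_span_image[OF matrix_vector_mul_linear, symmetric] image_image)
    finally obtain X where X: "X \<in> span (e ` {j. lt i j})" and eq: "h *v e i = h *v X"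
      by (auto simp: f_def)
    from eq have "e i = X" by (metis GL_cancel_left[OF h])
    moreover have "span (e ` {j. lt i j}) \<subseteq> {X. X $ i = 0}"
      by (rule span_minimal) (auto simp: e_nth irrefl subspace_def)
    ultimately show False using X by (auto simp: e_nth)
  qed
  have "\<exists>z. z \<noteq> 0 \<and> (\<forall>w\<in>U i. z \<bullet> w = 0) \<and> z \<in> span (insert (f i) (U i))" for i
  proof -
    obtain y z where y: "y \<in> span (U i)" and z: "\<And>w. w \<in> span (U i) \<Longrightarrow> orthogonal z w" and eq: "f i = y + z"
      using orthogonal_subspace_decomp_exists[of "U i" "f i"] by blast
    have U: "span (U i) = U i" by (simp add: U_def span_span)
    have "z \<noteq> 0" using notin[of i] y eq by (auto simp: U)
    moreover have "f i - y \<in> span (insert (f i) (U i))"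
      using y span_mono[of "U i" "insert (f i) (U i)"] by (intro span_diff) (auto intro: span_base)
    ultimately show ?thesis
      using z eq by (auto simp: U orthogonal_def)
  qed
  then obtain z where z: "\<And>i. z i \<noteq> 0" "\<And>i w. w \<in> U i \<Longrightarrow> z i \<bullet> w = 0" "\<And>i. z i \<in> span (insert (f i) (U i))"
    by metis
  have fU: "f j \<in> U i" if "lt i j" for i j
    using that by (auto simp: U_def intro: span_base)
  have zU: "z j \<in> U i" if "lt i j" for i j
  proof -
    have "U j \<subseteq> U i" unfolding U_def by (rule span_mono) (auto intro: trans[OF that])
    then have "span (insert (f j) (U j)) \<subseteq> U i"
      using fU[OF that] by (intro span_minimal) (auto simp: U_def)
    then show ?thesis using z(3)[of j] by blast
  qed
  define k where "k = (\<chi> i. z i /\<^sub>R norm (z i))"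
  show thesis
  proof
    have row: "row i k = z i /\<^sub>R norm (z i)" for i
      by (simp add: k_def row_def vec_eq_iff)
    have "orthogonal (row i k) (row j k)" if "i \<noteq> j" for i j
      using total[OF that] z(2)[OF zU, of i j] z(2)[OF zU, of j i]
      by (auto simp: row orthogonal_def inner_commute)
    then show "orthogonal_matrix k"
      using z(1) by (simp add: orthogonal_matrix_orthonormal_rows row)
    show "(k ** h) $ i $ j = 0" if "a i < a j" for i j
    proof -
      have "z i \<bullet> f j = 0" using that by (intro z(2) fU) (simp add: lt_def)
      moreover have "(k ** h) $ i $ j = (k *v f j) $ i"
        by (simp add: f_def matrix_matrix_mult_def matrix_vector_mult_def e_nth if_distrib cong: if_cong)
      ultimately show ?thesis
        by (simp add: matrix_vector_mul_component k_def)
    qed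
  qed
qed

text \<open>
  The vanishing entries say only that \<open>b\<close> maps each flag space into itself; an injective linear map of a
  finite-dimensional space into itself is onto, which gives the converse.
\<close>

lemma triangular_flag:
  fixes b :: "'n::finite mat"
  assumes b: "b \<in> GL" "\<And>i j. a i < a j \<Longrightarrow> b $ i $ j = 0"
  shows "b *v X \<in> flag a c \<longleftrightarrow> X \<in> flag a c"
proof -
  have inj: "inj ((*v) b)" by (rule inj_on_inverseI[where g = "(*v) (matrix_inv b)"]) (rule GL_cancel_left[OF b(1)])
  have into: "b *v X \<in> flag a c" if "X \<in> flag a c" for X
  proof -
    have "b $ i $ j * X $ j = 0" if "a i < c" for i j
      using b(2)[of i j] \<open>X \<in> flag a c\<close> that by (cases "a j < c") (auto simp: flag_def)
    then show ?thesis by (auto simp: flag_def matrix_vector_mult_def intro!: sum.neutral)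
  qed
  have "(*v) b ` flag a c = flag a c"
  proof (rule subspace_dim_equal)
    show "dim (flag a c) \<le> dim ((*v) b ` flag a c)"
      using dim_image_eq[OF matrix_vector_mul_linear inj_on_subset[OF inj]] by simp
  qed (use into in \<open>auto intro: subspace_flag linear_subspace_image\<close>)
  then show ?thesis using into injD[OF inj] by (metis image_iff)
qed

text \<open>
  The condition on weights defining \<open>W \<beta>\<close> depends on the basis; expressed through the flag of the diagonal of \<open>\<beta>\<close> it is visibly stable
  under every change of basis that preserves the flag.
\<close>

lemma mem_W_iff_flag:
  fixes \<mu> :: "'n::{finite,linorder} bil" and \<beta> :: "'n mat"
  assumes \<mu>: "\<mu> \<in> V"
  defines "a \<equiv> \<lambda>i. \<beta> $ i $ i"
  shows "\<mu> \<in> W \<beta> \<longleftrightarrow> (\<forall>c d. \<forall>X\<in>flag a c. \<forall>Y\<in>flag a d. \<mu> X Y \<in> flag a (c + d + (norm \<beta>)\<^sup>2))"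
proof
  assume W: "\<mu> \<in> W \<beta>"
  have lt: "a k - a i - a j \<ge> (norm \<beta>)\<^sup>2" if "i < j" "sc \<mu> i j k \<noteq> 0" for i j k
    using W that by (auto simp: W_def inner_\<alpha> a_def)
  have all: "a i + a j + (norm \<beta>)\<^sup>2 \<le> a k" if nz: "sc \<mu> i j k \<noteq> 0" for i j k
  proof (cases i j rule: linorder_cases)
    case less then show ?thesis using lt[OF less nz] by simp
  next
    case equal then show ?thesis using nz sc_skew[OF \<mu>, of i i k] by simp
  next
    case greater then show ?thesis using lt[OF greater, of k] nz sc_skew[OF \<mu>, of i j k] by simp
  qed
  show "\<forall>c d. \<forall>X\<in>flag a c. \<forall>Y\<in>flag a d. \<mu> X Y \<in> flag a (c + d + (norm \<beta>)\<^sup>2)"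
  proof (intro allI ballI)
    fix c d X Y assume X: "X \<in> flag a c" and Y: "Y \<in> flag a d"
    have "X $ i * Y $ j * sc \<mu> i j k = 0" if "a k < c + d + (norm \<beta>)\<^sup>2" for i j k
      using X Y all[of i j k] that by (cases "a i < c"; cases "a j < d") (auto simp: flag_def)
    then show "\<mu> X Y \<in> flag a (c + d + (norm \<beta>)\<^sup>2)"
      unfolding bilinear_basis_expansion[OF V_bilinear[OF \<mu>], of X Y]
      by (auto simp: flag_def sc_nth intro!: sum.neutral)
  qed
next
  assume R: "\<forall>c d. \<forall>X\<in>flag a c. \<forall>Y\<in>flag a d. \<mu> X Y \<in> flag a (c + d + (norm \<beta>)\<^sup>2)"
  have "a k - a i - a j \<ge> (norm \<beta>)\<^sup>2" if "sc \<mu> i j k \<noteq> 0" for i j k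
  proof -
    have "\<mu> (e i) (e j) \<in> flag a (a i + a j + (norm \<beta>)\<^sup>2)"
      using R by (simp add: axis_in_flag)
    then show ?thesis using that by (force simp: flag_def sc_nth)
  qed
  then show "\<mu> \<in> W \<beta>" using \<mu> by (simp add: W_def inner_\<alpha> a_def)
qed

text \<open>
  Used in two cases: \<open>\<gamma> = \<beta>\<close> with \<open>g\<close> in the parabolic group of \<open>\<beta>\<close>, and \<open>\<gamma>\<close> a rearrangement of \<open>\<beta>\<close> with
  \<open>g\<close> the corresponding permutation matrix.
\<close>

lemma act_mem_W:
  fixes \<mu> :: "'n::{finite,linorder} bil"
  assumes \<mu>: "\<mu> \<in> W \<beta>" and g: "g \<in> GL" and norm: "norm \<gamma> = norm \<beta>"
    and flag: "\<And>X c. g *v X \<in> flag (\<lambda>i. \<gamma> $ i $ i) c \<longleftrightarrow> X \<in> flag (\<lambda>i. \<beta> $ i $ i) c"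
  shows "act g \<mu> \<in> W \<gamma>"
proof -
  have V: "\<mu> \<in> V" using \<mu> by (simp add: W_def)
  have inv: "matrix_inv g *v X \<in> flag (\<lambda>i. \<beta> $ i $ i) c" if "X \<in> flag (\<lambda>i. \<gamma> $ i $ i) c" for X c
    using that by (simp add: GL_cancel_right[OF g] flip: flag)
  show ?thesis
    unfolding mem_W_iff_flag[OF act_V[OF V]]
    using \<mu>[unfolded mem_W_iff_flag[OF V]] by (auto simp: act_def flag norm inv)
qed

section \<open>Lower bounds for F\<close>

lemma W_norm_le_hull:
  assumes "\<mu> \<in> W \<beta>" "\<gamma> \<in> convex hull (weights \<mu>)"
  shows "(norm \<beta>)\<^sup>2 \<le> \<beta> \<bullet> \<gamma>"
proof -
  have "convex hull (weights \<mu>) \<subseteq> {\<gamma>. \<beta> \<bullet> \<gamma> \<ge> (norm \<beta>)\<^sup>2}"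
    by (rule hull_minimal) (use assms(1) in \<open>auto simp: W_def weights_def convex_halfspace_ge\<close>)
  then show ?thesis using assms(2) by blast
qed

lemma W_norm_le_\<beta>min:
  assumes "\<mu> \<in> W \<beta>" "\<mu> \<noteq> (\<lambda>X Y. 0)"
  shows "norm \<beta> \<le> norm (\<beta>min \<mu>)"
proof -
  have "\<mu> \<in> V" using assms(1) by (simp add: W_def)
  have "(norm \<beta>)\<^sup>2 \<le> \<beta> \<bullet> \<beta>min \<mu>"
    by (rule W_norm_le_hull[OF assms(1) \<beta>min_in_hull[OF \<open>\<mu> \<in> V\<close> assms(2)]])
  also have "\<dots> \<le> norm \<beta> * norm (\<beta>min \<mu>)" by (rule norm_cauchy_schwarz)
  finally show ?thesis
    by (cases "norm \<beta> = 0") (auto simp: power2_eq_square)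
qed

text \<open>
  This is the variational inequality for the point of a convex set closest to the origin.
\<close>

lemma mem_W_\<beta>min:
  fixes \<mu> :: "'n::{finite,linorder} bil"
  assumes \<mu>: "\<mu> \<in> V" "\<mu> \<noteq> (\<lambda>X Y. 0)"
  shows "\<mu> \<in> W (\<beta>min \<mu>)"
proof -
  have "\<beta>min \<mu> \<bullet> \<gamma> \<ge> (norm (\<beta>min \<mu>))\<^sup>2" if "\<gamma> \<in> weights \<mu>" for \<gamma>
  proof -
    have "inner (0 - \<beta>min \<mu>) (\<gamma> - \<beta>min \<mu>) \<le> 0"
      by (rule any_closest_point_dot[of "convex hull (weights \<mu>)"])
        (use \<beta>min_in_hull[OF \<mu>] \<beta>min_le[OF \<mu>] finite_weights hull_inc[OF that] in
          \<open>auto intro: compact_imp_closed finite_imp_compact_convex_hull\<close>)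
    then show ?thesis by (simp add: inner_diff_right power2_norm_eq_inner)
  qed
  then show ?thesis using \<mu>(1) by (auto simp: W_def weights_def)
qed

text \<open>
  The key estimate. With \<open>k = b ** g\<close> orthogonal and \<open>b\<close> preserving the flag of \<open>\<beta>min (act g \<mu>)\<close>, replacing \<open>g\<close> by
  \<open>k\<close> does not make \<open>\<beta>min\<close> shorter, and \<open>F\<close> takes the same value at \<open>\<mu>\<close> and at \<open>act k \<mu>\<close>.
\<close>

lemma F_ge_\<beta>min_act:
  fixes \<mu> :: "'n::{finite,linorder} bil"
  assumes \<mu>: "\<mu> \<in> V" "\<mu> \<noteq> (\<lambda>X Y. 0)" and g: "g \<in> GL"
  shows "F \<mu> \<ge> (norm (\<beta>min (act g \<mu>)))\<^sup>2"
proof -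
  define \<beta> where "\<beta> = \<beta>min (act g \<mu>)"
  have W: "act g \<mu> \<in> W \<beta>"
    unfolding \<beta>_def by (intro mem_W_\<beta>min act_V act_nonzero \<mu> g)
  obtain k where k: "orthogonal_matrix k"
    and tri: "\<And>i j. \<beta> $ i $ i < \<beta> $ j $ j \<Longrightarrow> (k ** matrix_inv g) $ i $ j = 0"
    by (rule orthogonal_times_triangular[OF GL_inverse[OF g], of "\<lambda>i. \<beta> $ i $ i"]) blast
  let ?b = "k ** matrix_inv g"
  have b: "?b \<in> GL" by (intro GL_mult GL_inverse g orthogonal_GL k)
  have "act ?b (act g \<mu>) = act (k ** (matrix_inv g ** g)) \<mu>"
    by (simp add: act_act b g matrix_mul_assoc)
  then have eq: "act ?b (act g \<mu>) = act k \<mu>" by (simp add: GL_left_inverse[OF g])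
  have "act ?b (act g \<mu>) \<in> W \<beta>"
    by (rule act_mem_W[OF W b refl]) (rule triangular_flag[OF b tri])
  then have "norm \<beta> \<le> norm (\<beta>min (act k \<mu>))"
    unfolding eq by (rule W_norm_le_\<beta>min[OF _ act_nonzero[OF orthogonal_GL[OF k] \<mu>(2)]])
  then have "(norm \<beta>)\<^sup>2 \<le> (norm (\<beta>min (act k \<mu>)))\<^sup>2" by simp
  also have "\<dots> \<le> F (act k \<mu>)"
    by (intro F_ge_\<beta>min act_V act_nonzero \<mu> orthogonal_GL k)
  also have "\<dots> = F \<mu>" by (rule F_act_orthogonal[OF \<mu>(1) k])
  finally show ?thesis by (simp add: \<beta>_def)
qed

lemma orbit_self: "\<mu> \<in> orbit \<mu>"
  using GL_one by (force simp: orbit_def act_one)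

lemma Inf_F_ge_\<beta>min_act:
  fixes \<mu> :: "'n::{finite,linorder} bil"
  assumes \<mu>: "\<mu> \<in> V" "\<mu> \<noteq> (\<lambda>X Y. 0)" and \<nu>: "\<nu> \<in> orbit \<mu>"
  shows "(norm (\<beta>min \<nu>))\<^sup>2 \<le> Inf (F ` orbit \<mu>)"
proof (rule cInf_greatest)
  show "F ` orbit \<mu> \<noteq> {}" using orbit_self by blast
  fix x assume "x \<in> F ` orbit \<mu>"
  then obtain g where g: "g \<in> GL" and x: "x = F (act g \<mu>)" by (auto simp: orbit_def)
  from \<nu> have "\<nu> \<in> orbit (act g \<mu>)" by (simp add: orbit_act[OF g])
  then show "(norm (\<beta>min \<nu>))\<^sup>2 \<le> x"
    using F_ge_\<beta>min_act[OF act_V[OF \<mu>(1)] act_nonzero[OF g \<mu>(2)]] by (auto simp: orbit_def x)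
qed

lemma S_lower_bound:
  fixes \<mu> :: "'n::{finite,linorder} bil"
  assumes "\<mu> \<in> S \<beta>"
  shows "F \<mu> \<ge> (norm \<beta>)\<^sup>2"
  using assms F_ge_\<beta>min_act[of \<mu>] by (auto simp: S_def orbit_def)

text \<open>
  The infimum bounds \<open>\<beta>min\<close> from above on the whole orbit, and \<open>\<mu> \<in> W \<beta>\<close> bounds \<open>\<beta>min \<mu>\<close> from below, so
  \<open>\<beta>min \<mu>\<close> has the norm of \<open>\<beta>\<close>. Then equality holds in the Cauchy-Schwarz inequality for \<open>\<beta>\<close> and \<open>\<beta>min \<mu>\<close>, hence the two vectors coincide and \<open>\<beta>\<close> is attained
  at \<open>\<mu>\<close> itself.
\<close>

lemma S_of_Inf_F:
  fixes \<mu> :: "'n::{finite,linorder} bil"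
  assumes W: "\<mu> \<in> W \<beta>" and nz: "\<mu> \<noteq> (\<lambda>X Y. 0)" and Inf: "Inf (F ` orbit \<mu>) = (norm \<beta>)\<^sup>2"
  shows "\<mu> \<in> S \<beta>"
proof -
  have V: "\<mu> \<in> V" using W by (simp add: W_def)
  have le: "norm (\<beta>min \<nu>) \<le> norm \<beta>" if "\<nu> \<in> orbit \<mu>" for \<nu>
    using Inf_F_ge_\<beta>min_act[OF V nz that] unfolding Inf by (rule power2_le_imp_le) simp
  have norm: "norm (\<beta>min \<mu>) = norm \<beta>"
    using le[OF orbit_self] W_norm_le_\<beta>min[OF W nz] by simp
  have "(norm (\<beta> - \<beta>min \<mu>))\<^sup>2 = 2 * ((norm \<beta>)\<^sup>2 - \<beta> \<bullet> \<beta>min \<mu>)"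
    using norm by (simp add: power2_norm_eq_inner norm_eq inner_diff inner_commute algebra_simps)
  also have "\<dots> \<le> 0"
    using W_norm_le_hull[OF W \<beta>min_in_hull[OF V nz]] by simp
  finally have "\<beta> = \<beta>min \<mu>" by simp
  then show ?thesis
    using V nz le orbit_self[of \<mu>] by (auto simp: S_def)
qed

lemma S_act:
  assumes "g \<in> GL" "act g \<mu> \<in> S \<beta>" "\<mu> \<in> V" "\<mu> \<noteq> (\<lambda>X Y. 0)"
  shows "\<mu> \<in> S \<beta>"
  using assms by (simp add: S_def orbit_act)

section \<open>Sorted diagonal matrices\<close>

text \<open>
  A permutation maximising the sum of \<open>idx i * a (q i)\<close> is sorting, by the rearrangement inequality: exchanging two
  entries in the wrong order would increase the sum.
\<close>

lemma exists_sorting_bijection: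
  fixes a :: "'n::{finite,linorder} \<Rightarrow> real"
  obtains q :: "'n \<Rightarrow> 'n" where "bij q" "mono (\<lambda>i. a (q i))"
proof -
  define idx :: "'n \<Rightarrow> real" where "idx i = card {..<i}" for i
  have idx: "idx i < idx j" if "i < j" for i j
    using that unfolding idx_def by (auto intro!: psubset_card_mono)
  let ?f = "\<lambda>q::'n\<Rightarrow>'n. \<Sum>i\<in>UNIV. idx i * a (q i)"
  have "finite {q::'n\<Rightarrow>'n. bij q}" by simp
  moreover have "{q::'n\<Rightarrow>'n. bij q} \<noteq> {}" using bij_id by blast
  ultimately obtain q where q: "bij q" and max: "\<And>r. bij r \<Longrightarrow> ?f r \<le> ?f q"
    using Max_in[of "?f ` {q. bij q}"] Max_ge[of "?f ` {q. bij q}"] by fastforce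
  have "a (q i) \<le> a (q j)" if "i < j" for i j
  proof (rule ccontr)
    assume gt: "\<not> a (q i) \<le> a (q j)"
    let ?r = "q \<circ> Transposition.transpose i j"
    have "?f ?r - ?f q = (\<Sum>l\<in>UNIV. idx l * (a (?r l) - a (q l)))"
      by (simp add: right_diff_distrib sum_subtractf)
    also have "\<dots> = (\<Sum>l\<in>{i,j}. idx l * (a (?r l) - a (q l)))"
      by (rule sum.mono_neutral_right) (auto simp: Transposition.transpose_def)
    also have "\<dots> = (idx j - idx i) * (a (q i) - a (q j))"
      using that by (simp add: algebra_simps)
    also have "\<dots> > 0" using idx[OF that] gt by simp
    finally show False using max[of ?r] q by (simp add: bij_comp)
  qed
  then have "mono (\<lambda>i. a (q i))" by (intro monoI) (auto simp: le_less)
  with q show thesis by (rule that)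
qed

text \<open>
  If \<open>a i < b i\<close>, then \<open>q\<close> would inject the indices up to \<open>i\<close> into those strictly below \<open>i\<close>. The reverse
  inequality follows by exchanging \<open>a\<close> and \<open>b\<close>.
\<close>

lemma mono_rearrangement_ge:
  fixes a b :: "'n::{finite,linorder} \<Rightarrow> real"
  assumes a: "mono a" and b: "mono b" and q: "bij q" and ab: "\<And>i. a i = b (q i)"
  shows "a i \<ge> b i"
proof (rule ccontr)
  assume "\<not> a i \<ge> b i"
  then have lt: "a i < b i" by simp
  have "q ` {..i} \<subseteq> {..<i}"
  proof
    fix x assume "x \<in> q ` {..i}"
    then obtain j where j: "j \<le> i" "x = q j" by auto
    have "b x \<le> a i" using monoD[OF a j(1)] by (simp add: j(2) ab)
    then have "\<not> i \<le> x" using lt monoD[OF b, of i x] by auto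
    then show "x \<in> {..<i}" by simp
  qed
  then have "card (q ` {..i}) \<le> card {..<i}" by (intro card_mono) auto
  moreover have "card (q ` {..i}) = card {..i}"
    by (rule card_image) (use q in \<open>auto simp: bij_def intro: inj_on_subset\<close>)
  moreover have "card {..<i} < card {..i}" by (rule psubset_card_mono) auto
  ultimately show False by simp
qed

lemma diagonal_mult_left: "A \<in> t \<Longrightarrow> (A ** g) $ i $ j = A $ i $ i * g $ i $ j"
  unfolding matrix_matrix_mult_def t_def
  by (simp, subst sum.remove[of _ i]) (auto intro!: sum.neutral)

lemma diagonal_mult_right: "A \<in> t \<Longrightarrow> (g ** A) $ i $ j = g $ i $ j * A $ j $ j"
  unfolding matrix_matrix_mult_def t_def
  by (simp, subst sum.remove[of _ j]) (auto intro!: sum.neutral)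

text \<open>
  An entry of \<open>g\<close> at \<open>(i, j)\<close> can be nonzero only if the \<open>i\<close>-th diagonal entry of \<open>A\<close> equals the \<open>j\<close>-th of \<open>B\<close>. A nonzero term of the Leibniz formula
  for \<open>det g\<close> then gives a permutation carrying one diagonal to the other.
\<close>

lemma sorted_conjugate_unique:
  fixes A B :: "'n::{finite,linorder} mat"
  assumes A: "A \<in> t_plus" and B: "B \<in> t_plus" and g: "g \<in> GL" and eq: "A ** g = g ** B"
  shows "A = B"
proof -
  have diag: "A \<in> t" "B \<in> t" using A B by (auto simp: t_plus_def)
  have mono: "mono (\<lambda>i. A $ i $ i)" "mono (\<lambda>i. B $ i $ i)"
    using A B by (auto simp: t_plus_def intro!: monoI)
  have ev: "A $ i $ i = B $ j $ j" if "g $ i $ j \<noteq> 0" for i j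
    using arg_cong[OF eq, of "\<lambda>M. M $ i $ j"] that
    by (simp add: diagonal_mult_left[OF diag(1)] diagonal_mult_right[OF diag(2)])
  have "det g \<noteq> 0" using g by (simp add: GL_def invertible_det_nz)
  then obtain q where q: "q permutes UNIV" and "(\<Prod>i\<in>UNIV. g $ i $ q i) \<noteq> 0"
    unfolding det_def by (metis (mono_tags, lifting) mem_Collect_eq mult_zero_right sum.neutral)
  then have Aq: "A $ i $ i = B $ q i $ q i" for i by (intro ev) simp
  have Bq: "B $ i $ i = A $ inv q i $ inv q i" for i
    using Aq[of "inv q i"] permutes_inverses(1)[OF q] by simp
  have bij: "bij q" "bij (inv q)" using q by (auto intro: permutes_bij permutes_inv)
  have "A $ i $ i = B $ i $ i" for i
    using mono_rearrangement_ge[OF mono bij(1) Aq, of i]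
      mono_rearrangement_ge[OF mono(2,1) bij(2) Bq, of i] by simp
  then show "A = B"
    using diag by (auto simp: vec_eq_iff t_def) metis
qed

lemma \<beta>min_in_t:
  fixes \<mu> :: "'n::{finite,linorder} bil"
  assumes "\<mu> \<in> V" "\<mu> \<noteq> (\<lambda>X Y. 0)"
  shows "\<beta>min \<mu> \<in> t"
proof -
  have "convex hull (weights \<mu>) \<subseteq> t"
  proof (rule hull_minimal)
    have "subspace (t :: 'n mat set)" by (auto simp: t_def subspace_def)
    then show "convex (t :: 'n mat set)" by (rule subspace_imp_convex)
  qed (auto simp: weights_def t_def \<alpha>_nth)
  then show ?thesis using \<beta>min_in_hull[OF assms] by blast
qed

text \<open>
  The matrix \<open>w\<close> permutes the coordinates so that the diagonal of \<open>\<beta>\<close> becomes increasing; flags are permuted along with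
  the coordinates.
\<close>

lemma exists_sorting_matrix:
  fixes \<beta> :: "'n::{finite,linorder} mat"
  assumes \<beta>: "\<beta> \<in> t"
  obtains w \<gamma> where "orthogonal_matrix w" "\<gamma> \<in> t_plus" "\<gamma> = w ** \<beta> ** matrix_inv w" "norm \<gamma> = norm \<beta>"
    "\<And>X c. w *v X \<in> flag (\<lambda>i. \<gamma> $ i $ i) c \<longleftrightarrow> X \<in> flag (\<lambda>i. \<beta> $ i $ i) c"
proof -
  obtain q :: "'n \<Rightarrow> 'n" where q: "bij q" and mono: "mono (\<lambda>i. \<beta> $ q i $ q i)"
    by (rule exists_sorting_bijection[of "\<lambda>i. \<beta> $ i $ i"]) blast
  define w :: "'n mat" where "w = (\<chi> i. e (q i))"
  define \<gamma> :: "'n mat" where "\<gamma> = (\<chi> i j. if i = j then \<beta> $ q i $ q i else 0)"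
  have w: "orthogonal_matrix w"
    using q by (auto simp: orthogonal_matrix_orthonormal_rows w_def row_def orthogonal_def inner_axis_axis
        dest: bij_is_inj injD)
  have w_nth: "(w *v X) $ i = X $ q i" for X i
    by (simp add: matrix_vector_mul_component w_def inner_axis')
  have "\<gamma> \<in> t" by (simp add: \<gamma>_def t_def)
  then have plus: "\<gamma> \<in> t_plus" using monoD[OF mono] by (auto simp: t_plus_def \<gamma>_def)
  have "\<gamma> ** w = w ** \<beta>"
    by (simp add: vec_eq_iff diagonal_mult_left[OF \<open>\<gamma> \<in> t\<close>] diagonal_mult_right[OF \<beta>])
      (simp add: w_def \<gamma>_def e_nth)
  then have "w ** \<beta> ** matrix_inv w = \<gamma> ** (w ** matrix_inv w)"
    by (simp add: matrix_mul_assoc)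
  then have conj: "\<gamma> = w ** \<beta> ** matrix_inv w"
    by (simp add: GL_right_inverse[OF orthogonal_GL[OF w]])
  have sq: "A \<bullet> A = (\<Sum>i\<in>UNIV. (A $ i $ i)\<^sup>2)" if "A \<in> t" for A :: "'n mat"
  proof -
    have "(\<Sum>j\<in>UNIV. A $ i $ j * A $ i $ j) = A $ i $ i * A $ i $ i" for i
      using that by (subst sum.remove[of _ i]) (auto simp: t_def intro!: sum.neutral)
    then show ?thesis by (simp add: inner_vec_def power2_eq_square)
  qed
  have "\<gamma> \<bullet> \<gamma> = (\<Sum>i\<in>UNIV. (\<beta> $ q i $ q i)\<^sup>2)" by (simp add: sq[OF \<open>\<gamma> \<in> t\<close>]) (simp add: \<gamma>_def)
  also have "\<dots> = \<beta> \<bullet> \<beta>"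
    unfolding sq[OF \<beta>] by (rule sum.reindex_bij_betw[OF q])
  finally have norm: "norm \<gamma> = norm \<beta>" by (simp add: norm_eq)
  have all_q: "(\<forall>i. P (q i)) \<longleftrightarrow> (\<forall>i. P i)" for P
    using bij_is_surj[OF q] by (metis surjD)
  have "w *v X \<in> flag (\<lambda>i. \<gamma> $ i $ i) c \<longleftrightarrow> X \<in> flag (\<lambda>i. \<beta> $ i $ i) c" for X c
  proof -
    have "w *v X \<in> flag (\<lambda>i. \<gamma> $ i $ i) c \<longleftrightarrow> (\<forall>i. \<beta> $ q i $ q i < c \<longrightarrow> X $ q i = 0)"
      by (simp add: flag_def w_nth \<gamma>_def)
    also have "\<dots> \<longleftrightarrow> (\<forall>i. \<beta> $ i $ i < c \<longrightarrow> X $ i = 0)"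
      by (rule all_q[of "\<lambda>i. \<beta> $ i $ i < c \<longrightarrow> X $ i = 0"])
    also have "\<dots> \<longleftrightarrow> X \<in> flag (\<lambda>i. \<beta> $ i $ i) c"
      by (simp add: flag_def)
    finally show ?thesis .
  qed
  with w plus conj norm show thesis by (rule that)
qed

text \<open>
  Any two sorted conjugates of \<open>\<beta>min \<mu>\<close> are conjugate to each other and therefore equal. Existence and membership in \<open>S\<close>
  come from the permutation matrix of \<open>exists_sorting_matrix\<close>.
\<close>

lemma S_sorted_of_Inf_F:
  fixes \<mu> :: "'n::{finite,linorder} bil"
  assumes \<mu>: "\<mu> \<in> V" "\<mu> \<noteq> (\<lambda>X Y. 0)" and Inf: "Inf (F ` orbit \<mu>) = (norm (\<beta>min \<mu>))\<^sup>2"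
  shows "\<exists>\<beta>. (\<beta> \<in> t_plus \<and> conjugate \<beta> (\<beta>min \<mu>))
         \<and> (\<forall>\<gamma>. \<gamma> \<in> t_plus \<and> conjugate \<gamma> (\<beta>min \<mu>) \<longrightarrow> \<gamma> = \<beta>)
         \<and> \<mu> \<in> S \<beta>"
proof -
  obtain w \<beta> where w: "orthogonal_matrix w" and \<beta>: "\<beta> \<in> t_plus" and conj: "\<beta> = w ** \<beta>min \<mu> ** matrix_inv w"
    and norm: "norm \<beta> = norm (\<beta>min \<mu>)"
    and flag: "\<And>X c. w *v X \<in> flag (\<lambda>i. \<beta> $ i $ i) c \<longleftrightarrow> X \<in> flag (\<lambda>i. \<beta>min \<mu> $ i $ i) c"
    by (rule exists_sorting_matrix[OF \<beta>min_in_t[OF \<mu>]]) blast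
  have wG: "w \<in> GL" by (rule orthogonal_GL[OF w])
  have "act w \<mu> \<in> S \<beta>"
  proof (rule S_of_Inf_F)
    show "act w \<mu> \<in> W \<beta>" by (rule act_mem_W[OF mem_W_\<beta>min[OF \<mu>] wG norm flag])
    show "act w \<mu> \<noteq> (\<lambda>X Y. 0)" by (rule act_nonzero[OF wG \<mu>(2)])
    show "Inf (F ` orbit (act w \<mu>)) = (norm \<beta>)\<^sup>2" by (simp add: orbit_act[OF wG] Inf norm)
  qed
  then have S: "\<mu> \<in> S \<beta>" by (rule S_act[OF wG _ \<mu>])
  have unique: "\<gamma> = \<beta>" if \<gamma>: "\<gamma> \<in> t_plus" "conjugate \<gamma> (\<beta>min \<mu>)" for \<gamma>
  proof -
    obtain g where g: "g \<in> GL" and "\<gamma> = g ** \<beta>min \<mu> ** matrix_inv g"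
      using \<gamma>(2) by (auto simp: conjugate_def)
    then have "\<gamma> ** (g ** matrix_inv w) = g ** \<beta>min \<mu> ** (matrix_inv g ** g) ** matrix_inv w"
      by (simp only: matrix_mul_assoc)
    also have "\<dots> = g ** (matrix_inv w ** w) ** \<beta>min \<mu> ** matrix_inv w"
      by (simp add: GL_left_inverse g wG)
    also have "\<dots> = (g ** matrix_inv w) ** \<beta>"
      unfolding conj by (simp only: matrix_mul_assoc)
    finally show ?thesis
      by (rule sorted_conjugate_unique[OF \<gamma>(1) \<beta> GL_mult[OF g GL_inverse[OF wG]]])
  qed
  show ?thesis
    using \<beta> S unique conj wG by (auto simp: conjugate_def)
qed

theorem proposition3p2:
  fixes \<mu> :: "'n::{finite,linorder} bil"
  assumes "\<mu> \<in> V" and "\<mu> \<noteq> (\<lambda>X Y. 0)"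
  shows
    "(p_t ((4 / (normV \<mu>)\<^sup>2) *\<^sub>R Ric \<mu>)
       = (2 / (normV \<mu>)\<^sup>2) *\<^sub>R (\<Sum>(i,j,k)\<in>{(i,j,k). i < j}. (sc \<mu> i j k)\<^sup>2 *\<^sub>R \<alpha> i j k)
     \<and> (2 / (normV \<mu>)\<^sup>2) *\<^sub>R (\<Sum>(i,j,k)\<in>{(i,j,k). i < j}. (sc \<mu> i j k)\<^sup>2 *\<^sub>R \<alpha> i j k)
       \<in> convex hull (weights \<mu>)
     \<and> F \<mu> \<ge> (norm (\<beta>min \<mu>))\<^sup>2)
   \<and> (\<forall>\<beta>\<in>t. \<mu> \<in> S \<beta> \<longrightarrow> F \<mu> \<ge> (norm \<beta>)\<^sup>2)
   \<and> (\<forall>\<beta>\<in>t. \<mu> \<in> W \<beta> \<and> Inf (F ` orbit \<mu>) = (norm \<beta>)\<^sup>2 \<longrightarrow> \<mu> \<in> S \<beta>)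
   \<and> (Inf (F ` orbit \<mu>) = (norm (\<beta>min \<mu>))\<^sup>2 \<longrightarrow>
      (\<exists>\<beta>. (\<beta> \<in> t_plus \<and> conjugate \<beta> (\<beta>min \<mu>))
         \<and> (\<forall>\<gamma>. \<gamma> \<in> t_plus \<and> conjugate \<gamma> (\<beta>min \<mu>) \<longrightarrow> \<gamma> = \<beta>)
         \<and> \<mu> \<in> S \<beta>))"
proof (intro conjI ballI impI)
  show "p_t ((4 / (normV \<mu>)\<^sup>2) *\<^sub>R Ric \<mu>)
       = (2 / (normV \<mu>)\<^sup>2) *\<^sub>R (\<Sum>(i,j,k)\<in>{(i,j,k). i < j}. (sc \<mu> i j k)\<^sup>2 *\<^sub>R \<alpha> i j k)"
    by (rule p_t_scaled_Ric[OF assms(1)])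
  show "(2 / (normV \<mu>)\<^sup>2) *\<^sub>R (\<Sum>(i,j,k)\<in>{(i,j,k). i < j}. (sc \<mu> i j k)\<^sup>2 *\<^sub>R \<alpha> i j k)
       \<in> convex hull (weights \<mu>)"
    by (rule weighted_average_in_hull[OF assms])
  show "F \<mu> \<ge> (norm (\<beta>min \<mu>))\<^sup>2" by (rule F_ge_\<beta>min[OF assms])
  show "F \<mu> \<ge> (norm \<beta>)\<^sup>2" if "\<mu> \<in> S \<beta>" for \<beta> using that by (rule S_lower_bound)
  show "\<mu> \<in> S \<beta>" if "\<mu> \<in> W \<beta> \<and> Inf (F ` orbit \<mu>) = (norm \<beta>)\<^sup>2" for \<beta>
    using that S_of_Inf_F[OF _ assms(2)] by blast
qed (rule S_sorted_of_Inf_F[OF assms])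

end
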